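(* Let $a, a_k$ ($k=1,2,3,\dots$) be selfadjoint operators on separable Hilbert spaces $H,H_k$ ($k=1,2,3,\dots$), respectively. Suppose that there exists $p\in\mathbb N$ such that $a\in\mathcal S^p(H)$ and $a_k\in\mathcal S^p(H_k)$ for all $k\in\mathbb N$. Suppose that $\mathrm{Tr}_{H_k}(a_k^n)\to\mathrm{Tr}_H(a^n)$ as $k\to\infty$ for any integer $n\ge p$. Then $a_k$ converges to $a$ in eigenvalues.
   Context: $\mathcal S^p(H)$ is the set of $p$-Schatten class operators on $H$; $\mathrm{Tr}_H$ is the trace on $H$; $\mathbb N=\{1,2,\dots\}$. Convergence in eigenvalues: for a selfadjoint compact operator $a$ on a separable Hilbert space, let $\lambda_1^+(a)\ge\lambda_2^+(a)\ge\cdots\ge0$ be its nonnegative eigenvalues (with multiplicity) in nonincreasing order and $\lambda_1^-(a)\le\lambda_2^-(a)\le\cdots\le0$ its nonpositive eigenvalues in nondecreasing order, finite lists being padded with infinitely many zeros. Then $a_k$ converges to $a$ in eigenvalues if $\lambda_i^{u}(a_k)\to\lambda_i^{u}(a)$ as $k\to\infty$ for all $i\ge1$, $u\in\{+,-\}$. *)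

theory Defs
  imports "HOL-Analysis.Analysis" "HOL-Algebra.Module"
begin

section \<open>Separable complex Hilbert spaces\<close>

text \<open>
  A Hilbert space is a record with an explicit carrier, so that a sequence of Hilbert spaces
  whose members are unrelated to each other is just a function into the record type.
  The vector space structure is that of a module over the field of complex numbers; the
  multiplicative fields \<open>mult\<close> and \<open>one\<close> that the record inherits from \<open>ring\<close> play no role.
\<close>

definition complex_field :: "complex ring" where
  "complex_field = \<lparr>carrier = UNIV, mult = (*), one = 1, zero = 0, add = (+)\<rparr>"

record 'a inner_space = "(complex, 'a) module" +
  inner_prod :: "'a \<Rightarrow> 'a \<Rightarrow> complex"

definition hnorm :: "('a, 'm) inner_space_scheme \<Rightarrow> 'a \<Rightarrow> real" where
  "hnorm H x = sqrt (Re (inner_prod H x x))"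

text \<open>The value \<open>0\<close> off the carrier is there because \<open>Metric_space\<close> requires
  nonnegativity and symmetry for all arguments.\<close>

definition hdist :: "('a, 'm) inner_space_scheme \<Rightarrow> 'a \<Rightarrow> 'a \<Rightarrow> real" where
  "hdist H x y =
    (if x \<in> carrier H \<and> y \<in> carrier H then hnorm H (x \<ominus>\<^bsub>H\<^esub> y) else 0)"

abbreviation norm_topology :: "('a, 'm) inner_space_scheme \<Rightarrow> 'a topology" where
  "norm_topology H \<equiv> Metric_space.mtopology (carrier H) (hdist H)"

locale complex_inner_space = module complex_field H
  for H :: "('a, 'm) inner_space_scheme" (structure) +
  assumes inner_add_left:
      "\<lbrakk>x \<in> carrier H; y \<in> carrier H; z \<in> carrier H\<rbrakk> \<Longrightarrow>
        inner_prod H (x \<oplus> y) z = inner_prod H x z + inner_prod H y z"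
    and inner_scale_left:
      "\<lbrakk>x \<in> carrier H; y \<in> carrier H\<rbrakk> \<Longrightarrow>
        inner_prod H (c \<odot> x) y = c * inner_prod H x y"
    and inner_commute:
      "\<lbrakk>x \<in> carrier H; y \<in> carrier H\<rbrakk> \<Longrightarrow> inner_prod H y x = cnj (inner_prod H x y)"
    and inner_pos:
      "\<lbrakk>x \<in> carrier H; x \<noteq> \<zero>\<rbrakk> \<Longrightarrow> 0 < Re (inner_prod H x x)"
begin

lemma smult_in [simp]: "x \<in> carrier H \<Longrightarrow> c \<odot> x \<in> carrier H"
  by (rule smult_closed) (simp_all add: complex_field_def)

lemma minus_conv_smult:
  assumes "x \<in> carrier H" shows "\<ominus> x = (-1) \<odot> x"
proof -
  have "(-1) \<odot> x \<oplus> x = ((-1) \<oplus>\<^bsub>complex_field\<^esub> 1) \<odot> x"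
    using smult_l_distr[of "-1" 1 x] smult_one[of x] assms by (simp add: complex_field_def)
  also have "\<dots> = \<zero>\<^bsub>complex_field\<^esub> \<odot> x" by (simp add: complex_field_def)
  also have "\<dots> = \<zero>" using assms by (rule smult_l_null)
  finally show ?thesis using assms by (metis M.minus_equality smult_in)
qed

lemma inner_add_right:
  "\<lbrakk>x \<in> carrier H; y \<in> carrier H; z \<in> carrier H\<rbrakk> \<Longrightarrow>
    inner_prod H x (y \<oplus> z) = inner_prod H x y + inner_prod H x z"
  using inner_add_left[of y z x] inner_commute[of _ x] by simp

lemma inner_scale_right:
  "\<lbrakk>x \<in> carrier H; y \<in> carrier H\<rbrakk> \<Longrightarrow> inner_prod H x (c \<odot> y) = cnj c * inner_prod H x y"
  using inner_scale_left[of y x c] inner_commute[of _ x] by simp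

lemma inner_zero_left: "x \<in> carrier H \<Longrightarrow> inner_prod H \<zero> x = 0"
  using inner_add_left[of \<zero> \<zero> x] by simp

lemma inner_self_ge_0: "x \<in> carrier H \<Longrightarrow> 0 \<le> Re (inner_prod H x x)"
  using inner_pos[of x] inner_zero_left[of \<zero>] by fastforce

lemma inner_self_real: "x \<in> carrier H \<Longrightarrow> inner_prod H x x = complex_of_real (Re (inner_prod H x x))"
  using inner_commute[of x x] by (simp add: complex_eq_iff)

lemma hnorm_square: "x \<in> carrier H \<Longrightarrow> (hnorm H x)\<^sup>2 = Re (inner_prod H x x)"
  by (simp add: hnorm_def inner_self_ge_0)

lemma hnorm_ge_0: "x \<in> carrier H \<Longrightarrow> 0 \<le> hnorm H x"
  by (simp add: hnorm_def inner_self_ge_0)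

lemma hnorm_eq_0: "x \<in> carrier H \<Longrightarrow> hnorm H x = 0 \<longleftrightarrow> x = \<zero>"
  using inner_pos[of x] inner_zero_left[of \<zero>] by (cases "x = \<zero>") (auto simp: hnorm_def)

lemma Cauchy_Schwarz:
  assumes x: "x \<in> carrier H" and y: "y \<in> carrier H"
  shows "cmod (inner_prod H x y) \<le> hnorm H x * hnorm H y"
proof (cases "y = \<zero>")
  case True
  then show ?thesis
    using inner_zero_left[OF x] inner_commute[of y x] x y hnorm_ge_0 by simp
next
  case False
  define r where "r = Re (inner_prod H y y)"
  have r: "r > 0" using inner_pos[OF y False] by (simp add: r_def)
  have yy: "inner_prod H y y = of_real r" using inner_self_real[OF y] by (simp add: r_def)
  define w where "w = inner_prod H x y"
  have yx: "inner_prod H y x = cnj w" using inner_commute[OF x y] by (simp add: w_def)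
  define c where "c = - w / of_real r"
  define z where "z = x \<oplus> c \<odot> y"
  have z: "z \<in> carrier H" using x y by (simp add: z_def)
  have "inner_prod H z z =
      inner_prod H x x + cnj c * w + c * cnj w + c * cnj c * of_real r"
    using x y by (simp add: z_def inner_add_left inner_add_right inner_scale_left
        inner_scale_right yy yx algebra_simps flip: w_def)
  also have "\<dots> = inner_prod H x x - w * cnj w / of_real r"
    using r by (simp add: c_def field_simps)
  also have "w * cnj w / of_real r = of_real ((cmod w)\<^sup>2 / r)"
    by (simp add: complex_norm_square del: of_real_power flip: of_real_mult)
  finally have "0 \<le> Re (inner_prod H x x) - (cmod w)\<^sup>2 / r"
    using inner_self_ge_0[OF z] by simp
  then have "(cmod w)\<^sup>2 \<le> Re (inner_prod H x x) * r"
    using r by (simp add: field_simps)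
  also have "\<dots> = (hnorm H x * hnorm H y)\<^sup>2"
    using x y by (simp add: power_mult_distrib hnorm_square r_def)
  finally show ?thesis
    unfolding w_def by (rule power2_le_imp_le) (simp add: x y hnorm_ge_0)
qed

lemma hnorm_triangle:
  assumes x: "x \<in> carrier H" and y: "y \<in> carrier H"
  shows "hnorm H (x \<oplus> y) \<le> hnorm H x + hnorm H y"
proof (rule power2_le_imp_le)
  have "(hnorm H (x \<oplus> y))\<^sup>2 =
      (hnorm H x)\<^sup>2 + 2 * Re (inner_prod H x y) + (hnorm H y)\<^sup>2"
    using x y inner_commute[OF x y]
    by (simp add: hnorm_square inner_add_left inner_add_right)
  also have "Re (inner_prod H x y) \<le> hnorm H x * hnorm H y"
    using Cauchy_Schwarz[OF x y] complex_Re_le_cmod order_trans by blast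
  finally show "(hnorm H (x \<oplus> y))\<^sup>2 \<le> (hnorm H x + hnorm H y)\<^sup>2"
    by (simp add: power2_sum)
qed (simp add: x y hnorm_ge_0)

lemma hnorm_minus: "x \<in> carrier H \<Longrightarrow> hnorm H (\<ominus> x) = hnorm H x"
  by (simp add: minus_conv_smult hnorm_def inner_scale_left inner_scale_right)

sublocale metric: Metric_space "carrier H" "hdist H"
proof
  fix x y
  show "0 \<le> hdist H x y" by (simp add: hdist_def hnorm_ge_0)
  have "x \<ominus> y = \<ominus> (y \<ominus> x)" if "x \<in> carrier H" "y \<in> carrier H"
    using that by (simp add: a_minus_def M.minus_add M.a_comm)
  then show "hdist H x y = hdist H y x" by (simp add: hdist_def hnorm_minus)
next
  fix x y assume *: "x \<in> carrier H" "y \<in> carrier H"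
  have "x \<ominus> y = \<zero> \<longleftrightarrow> x = y"
    using * M.minus_equality[of x "\<ominus> y"] by (auto simp: a_minus_def M.r_neg)
  with * show "hdist H x y = 0 \<longleftrightarrow> x = y"
    by (simp add: hdist_def hnorm_eq_0)
next
  fix x y z assume *: "x \<in> carrier H" "y \<in> carrier H" "z \<in> carrier H"
  have "x \<ominus> z = (x \<ominus> y) \<oplus> (y \<ominus> z)"
    using * by (simp add: a_minus_def M.a_assoc M.r_neg1)
  then show "hdist H x z \<le> hdist H x y + hdist H y z"
    using * hnorm_triangle[of "x \<ominus> y" "y \<ominus> z"] by (simp add: hdist_def)
qed

end

locale separable_hilbert_space = complex_inner_space +
  assumes complete: "metric.mcomplete"
    and separable: "separable_space (norm_topology H)"


section \<open>Operators, trace and eigenvalues\<close>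

text \<open>An operator on \<open>H\<close> is a function on the ambient type of which only the values on
  \<open>carrier H\<close> matter.\<close>

definition linear_op :: "('a, 'm) inner_space_scheme \<Rightarrow> ('a \<Rightarrow> 'a) \<Rightarrow> bool" where
  "linear_op H T \<longleftrightarrow>
    (\<forall>x\<in>carrier H. T x \<in> carrier H) \<and>
    (\<forall>x\<in>carrier H. \<forall>y\<in>carrier H. T (x \<oplus>\<^bsub>H\<^esub> y) = T x \<oplus>\<^bsub>H\<^esub> T y) \<and>
    (\<forall>c. \<forall>x\<in>carrier H. T (c \<odot>\<^bsub>H\<^esub> x) = c \<odot>\<^bsub>H\<^esub> T x)"

definition bounded_op :: "('a, 'm) inner_space_scheme \<Rightarrow> ('a \<Rightarrow> 'a) \<Rightarrow> bool" where
  "bounded_op H T \<longleftrightarrow>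
    linear_op H T \<and> (\<exists>C. \<forall>x\<in>carrier H. hnorm H (T x) \<le> C * hnorm H x)"

definition compact_op :: "('a, 'm) inner_space_scheme \<Rightarrow> ('a \<Rightarrow> 'a) \<Rightarrow> bool" where
  "compact_op H T \<longleftrightarrow>
    linear_op H T \<and>
    compactin (norm_topology H)
      (norm_topology H closure_of (T ` {x \<in> carrier H. hnorm H x \<le> 1}))"

definition selfadjoint_op :: "('a, 'm) inner_space_scheme \<Rightarrow> ('a \<Rightarrow> 'a) \<Rightarrow> bool" where
  "selfadjoint_op H T \<longleftrightarrow>
    bounded_op H T \<and>
    (\<forall>x\<in>carrier H. \<forall>y\<in>carrier H. inner_prod H (T x) y = inner_prod H x (T y))"

definition adjoint_op :: "('a, 'm) inner_space_scheme \<Rightarrow> ('a \<Rightarrow> 'a) \<Rightarrow> 'a \<Rightarrow> 'a" where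
  "adjoint_op H T y =
    (THE z. z \<in> carrier H \<and> (\<forall>x\<in>carrier H. inner_prod H (T x) y = inner_prod H x z))"

text \<open>Orthonormal bases in the Hilbert space sense, i.e. maximal orthonormal subsets, of the
  closed subspace \<open>S\<close>.\<close>

definition orthonormal_basis ::
    "('a, 'm) inner_space_scheme \<Rightarrow> 'a set \<Rightarrow> 'a set \<Rightarrow> bool" where
  "orthonormal_basis H S B \<longleftrightarrow>
    B \<subseteq> S \<and>
    (\<forall>e\<in>B. \<forall>f\<in>B. inner_prod H e f = (if e = f then 1 else 0)) \<and>
    (\<forall>x\<in>S. (\<forall>e\<in>B. inner_prod H x e = 0) \<longrightarrow> x = \<zero>\<^bsub>H\<^esub>)"

text \<open>For a trace class operator the series below converges absolutely with a sum that does not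
  depend on the orthonormal basis.\<close>

definition trace_op :: "('a, 'm) inner_space_scheme \<Rightarrow> ('a \<Rightarrow> 'a) \<Rightarrow> complex" where
  "trace_op H T =
    (THE t. \<forall>B. orthonormal_basis H (carrier H) B \<longrightarrow>
      ((\<lambda>e. inner_prod H (T e) e) has_sum t) B)"

definition eigenspace :: "('a, 'm) inner_space_scheme \<Rightarrow> ('a \<Rightarrow> 'a) \<Rightarrow> real \<Rightarrow> 'a set" where
  "eigenspace H T t = {x \<in> carrier H. T x = complex_of_real t \<odot>\<^bsub>H\<^esub> x}"

text \<open>\<open>t\<close> has (finite) multiplicity \<open>d\<close>; \<open>d = 0\<close> means that \<open>t\<close> is not an eigenvalue.\<close>

definition has_multiplicity ::
    "('a, 'm) inner_space_scheme \<Rightarrow> ('a \<Rightarrow> 'a) \<Rightarrow> real \<Rightarrow> nat \<Rightarrow> bool" where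
  "has_multiplicity H T t d \<longleftrightarrow>
    (\<exists>B. orthonormal_basis H (eigenspace H T t) B \<and> finite B \<and> card B = d)"

text \<open>
  The nonnegative eigenvalues in nonincreasing order and the nonpositive ones in nondecreasing
  order, each nonzero eigenvalue being listed as often as its multiplicity says and finite lists
  being padded with zeros: the entries that are not accounted for by nonzero eigenvalues are \<open>0\<close>,
  and they exist only if there are finitely many eigenvalues of the respective sign.
  For compact selfadjoint \<open>T\<close> there is exactly one such sequence.
  Indices start at \<open>0\<close>, so \<open>eig_pos H T i\<close> is \<open>\<lambda>\<close> with index \<open>i + 1\<close> in the usual counting.
\<close>

definition eig_pos :: "('a, 'm) inner_space_scheme \<Rightarrow> ('a \<Rightarrow> 'a) \<Rightarrow> nat \<Rightarrow> real" where
  "eig_pos H T = (THE l. decseq l \<and> (\<forall>i. 0 \<le> l i) \<and>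
    (\<forall>t>0. finite {i. l i = t} \<and> has_multiplicity H T t (card {i. l i = t})))"

definition eig_neg :: "('a, 'm) inner_space_scheme \<Rightarrow> ('a \<Rightarrow> 'a) \<Rightarrow> nat \<Rightarrow> real" where
  "eig_neg H T = (THE l. incseq l \<and> (\<forall>i. l i \<le> 0) \<and>
    (\<forall>t<0. finite {i. l i = t} \<and> has_multiplicity H T t (card {i. l i = t})))"

text \<open>Singular values are the square roots of the eigenvalues of \<open>T\<^sup>* T\<close>, which is
  compact, selfadjoint and nonnegative for compact \<open>T\<close>.\<close>

definition singular_value :: "('a, 'm) inner_space_scheme \<Rightarrow> ('a \<Rightarrow> 'a) \<Rightarrow> nat \<Rightarrow> real" where
  "singular_value H T i = sqrt (eig_pos H (adjoint_op H T \<circ> T) i)"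

definition schatten_class ::
    "nat \<Rightarrow> ('a, 'm) inner_space_scheme \<Rightarrow> ('a \<Rightarrow> 'a) set" where
  "schatten_class p H = {T. compact_op H T \<and> summable (\<lambda>i. singular_value H T i ^ p)}"

definition converges_in_eigenvalues ::
    "(nat \<Rightarrow> ('b, 'n) inner_space_scheme) \<Rightarrow> (nat \<Rightarrow> 'b \<Rightarrow> 'b) \<Rightarrow>
      ('a, 'm) inner_space_scheme \<Rightarrow> ('a \<Rightarrow> 'a) \<Rightarrow> bool" where
  "converges_in_eigenvalues Hs as H a \<longleftrightarrow>
    (\<forall>i. (\<lambda>k. eig_pos (Hs k) (as k) i) \<longlonglongrightarrow> eig_pos H a i) \<and>
    (\<forall>i. (\<lambda>k. eig_neg (Hs k) (as k) i) \<longlonglongrightarrow> eig_neg H a i)"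

end

theory Submission
  imports Defs
begin

text \<open>
  An even power \<open>q \<ge> p\<close> turns the eigenvalues \<open>\<mu>\<close> of each operator into a finite measure that gives
  every eigenvalue the mass \<open>\<mu> ^ q\<close>. The traces of the higher powers are the moments of these
  measures, the traces of the \<open>q\<close>-th powers bound the eigenvalues uniformly in \<open>k\<close>, and so by
  Weierstrass' theorem the sums of \<open>\<mu> ^ q * f \<mu>\<close> converge for continuous \<open>f\<close>. Taking for
  \<open>x ^ q * f x\<close> a ramp that vanishes near \<open>0\<close> compares the numbers of eigenvalues above a threshold,
  hence the \<open>i\<close>-th largest ones; the nonpositive eigenvalues are those of \<open>- \<mu>\<close>.

  The traces are sums over an orthonormal basis of eigenvectors. Such a basis is a maximal orthonormal
  set of eigenvectors: on its orthogonal complement, a sequence that nearly attains the norm \<open>s\<close> of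
  \<open>T\<close> has by compactness a subsequence converging to an eigenvector of \<open>T\<^sup>2\<close> for \<open>s\<^sup>2\<close>, and
  \<open>T\<^sup>2 - s\<^sup>2 = (T - s) (T + s)\<close>.
\<close>

section \<open>Decreasing rearrangements\<close>

text \<open>The eigenvalue lists, the trace and the adjoint are definite descriptions, so much of
  the work is uniqueness: a list is determined by its fibres, a multiplicity does not depend on the
  basis of the eigenspace, the trace does not depend on the basis of the space. All of it is reduced
  to one datum, a basis \<open>B\<close> with a real function \<open>\<mu>\<close>, after which only
  families of real numbers matter. The exponent \<open>q\<close> must be even because odd powers of
  eigenvalues of opposite sign cancel and give neither a measure nor a bound. It must be positive
  because the kernels may be infinite-dimensional and vary with \<open>k\<close>; the factor
  \<open>\<mu> ^ q\<close> removes them. The price is that only test functions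
  \<open>x ^ q * f x\<close> are available, so thresholds stay away from \<open>0\<close>. A count
  jumps at a threshold that is itself an eigenvalue; hence a ramp is squeezed between counts at two
  different thresholds. The Schatten hypothesis speaks of ordered singular values and is carried
  over to \<open>B\<close> by matching the nonzero entries.\<close>

definition dec_rearr :: "'a set \<Rightarrow> ('a \<Rightarrow> real) \<Rightarrow> nat \<Rightarrow> real" where
  "dec_rearr B \<mu> i = Sup (insert 0 {s. 0 < s \<and> i < card {e\<in>B. s \<le> \<mu> e}})"

text \<open>Finite level sets make \<open>card\<close> a genuine count in \<open>dec_rearr\<close>;
  for an infinite set it would be \<open>0\<close>. This is why only positive thresholds enter
  there, and the inserted \<open>0\<close> supplies the padding.\<close>

context
  fixes B :: "'a set" and \<mu> :: "'a \<Rightarrow> real"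
  assumes fin: "\<And>t. 0 < t \<Longrightarrow> finite {e\<in>B. t \<le> \<mu> e}"
begin

text \<open>A threshold above \<open>1\<close> that some value reaches is dominated by the finitely
  many values that are at least \<open>1\<close>.\<close>

lemma dec_rearr_bdd: "bdd_above (insert 0 {s. 0 < s \<and> i < card {e\<in>B. s \<le> \<mu> e}})"
proof -
  have f1: "finite {e\<in>B. 1 \<le> \<mu> e}" using fin[of 1] by simp
  have "s \<le> Max (insert 1 (\<mu> ` {e\<in>B. 1 \<le> \<mu> e}))" if "i < card {e\<in>B. s \<le> \<mu> e}" for s
  proof (cases "s \<le> 1")
    case True
    then show ?thesis using f1 by (intro order_trans[OF True]) auto
  next
    case False
    from that have "{e\<in>B. s \<le> \<mu> e} \<noteq> {}" by (metis card.empty less_nat_zero_code)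
    then obtain e where "e \<in> B" "s \<le> \<mu> e" by blast
    with False f1 show ?thesis
      by (intro order_trans[OF \<open>s \<le> \<mu> e\<close>] Max_ge) auto
  qed
  then show ?thesis
    by (intro bdd_aboveI[of _ "max 0 (Max (insert 1 (\<mu> ` {e\<in>B. 1 \<le> \<mu> e})))"])
       (auto simp del: Max_insert simp: le_max_iff_disj)
qed

lemma dec_rearr_nonneg: "0 \<le> dec_rearr B \<mu> i"
  unfolding dec_rearr_def by (rule cSup_upper[OF _ dec_rearr_bdd]) simp

text \<open>The supremum is attained: only finitely many values lie between \<open>t / 2\<close> and
  \<open>t\<close>, so just below \<open>t\<close> there is a gap in which the counting function is
  constant.\<close>

lemma le_dec_rearr_iff:
  assumes "0 < t"
  shows "t \<le> dec_rearr B \<mu> i \<longleftrightarrow> i < card {e\<in>B. t \<le> \<mu> e}"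
proof
  assume "i < card {e\<in>B. t \<le> \<mu> e}"
  then show "t \<le> dec_rearr B \<mu> i"
    unfolding dec_rearr_def using assms by (intro cSup_upper[OF _ dec_rearr_bdd]) simp
next
  assume t: "t \<le> dec_rearr B \<mu> i"
  show "i < card {e\<in>B. t \<le> \<mu> e}"
  proof (rule ccontr)
    assume *: "\<not> i < card {e\<in>B. t \<le> \<mu> e}"
    \<comment> \<open>\<open>Max A\<close> bounds the gap below \<open>t\<close>; the extra element
      \<open>t / 2\<close> keeps \<open>A\<close> nonempty and \<open>Max A\<close>
      positive.\<close>
    define A where "A = insert (t/2) (\<mu> ` {e\<in>B. t/2 \<le> \<mu> e \<and> \<mu> e < t})"
    have "finite {e\<in>B. t/2 \<le> \<mu> e \<and> \<mu> e < t}"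
      by (rule finite_subset[OF _ fin[of "t/2"]]) (use assms in auto)
    then have A: "finite A" "A \<noteq> {}" by (auto simp: A_def)
    have "Max A < t" using A assms by (auto simp: A_def)
    have "t/2 \<le> Max A" by (rule Max_ge[OF A(1)]) (simp add: A_def)
    then have "0 < Max A" using assms by linarith
    have "s \<le> Max A" if "0 < s" "i < card {e\<in>B. s \<le> \<mu> e}" for s
    proof (rule ccontr)
      assume s: "\<not> s \<le> Max A"
      have "{e\<in>B. s \<le> \<mu> e} \<subseteq> {e\<in>B. t \<le> \<mu> e}"
      proof safe
        fix e assume e: "e \<in> B" "s \<le> \<mu> e"
        show "t \<le> \<mu> e"
        proof (rule ccontr)
          assume "\<not> t \<le> \<mu> e"
          with e s \<open>t/2 \<le> Max A\<close> have "\<mu> e \<in> A" by (auto simp: A_def)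
          with A have "\<mu> e \<le> Max A" by simp
          with e s show False by simp
        qed
      qed
      then have "card {e\<in>B. s \<le> \<mu> e} \<le> card {e\<in>B. t \<le> \<mu> e}"
        by (intro card_mono fin assms)
      with that * show False by simp
    qed
    then have "dec_rearr B \<mu> i \<le> Max A"
      unfolding dec_rearr_def using \<open>0 < Max A\<close> by (intro cSup_least) auto
    with t \<open>Max A < t\<close> show False by simp
  qed
qed

text \<open>The values above \<open>t\<close> are finitely many, so their minimum is still strictly
  above \<open>t\<close> and serves as a threshold for \<open>le_dec_rearr_iff\<close>.\<close>

lemma less_dec_rearr_iff:
  assumes "0 < t"
  shows "t < dec_rearr B \<mu> i \<longleftrightarrow> i < card {e\<in>B. t < \<mu> e}"
proof
  assume t: "t < dec_rearr B \<mu> i"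
  then have "i < card {e\<in>B. dec_rearr B \<mu> i \<le> \<mu> e}"
    using le_dec_rearr_iff[of "dec_rearr B \<mu> i" i] assms by simp
  also have "\<dots> \<le> card {e\<in>B. t < \<mu> e}"
    by (rule card_mono[OF finite_subset[OF _ fin[OF assms]]]) (use t in auto)
  finally show "i < card {e\<in>B. t < \<mu> e}" .
next
  assume i: "i < card {e\<in>B. t < \<mu> e}"
  let ?A = "\<mu> ` {e\<in>B. t < \<mu> e}"
  have A: "finite ?A" by (rule finite_imageI, rule finite_subset[OF _ fin[OF assms]]) auto
  have "{e\<in>B. t < \<mu> e} \<noteq> {}" using i by (metis card.empty less_nat_zero_code)
  then have ne: "?A \<noteq> {}" by blast
  have "t < Min ?A" using A ne by (subst Min_gr_iff) auto
  have "i < card {e\<in>B. Min ?A \<le> \<mu> e}"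
    by (rule less_le_trans[OF i card_mono])
       (use A fin[of "Min ?A"] assms \<open>t < Min ?A\<close> in auto)
  then have "Min ?A \<le> dec_rearr B \<mu> i"
    using le_dec_rearr_iff[of "Min ?A" i] assms \<open>t < Min ?A\<close> by simp
  with \<open>t < Min ?A\<close> show "t < dec_rearr B \<mu> i" by simp
qed

lemma decseq_dec_rearr: "decseq (dec_rearr B \<mu>)"
proof (rule antimonoI, rule ccontr)
  fix i j :: nat assume ij: "i \<le> j"
  assume "\<not> dec_rearr B \<mu> j \<le> dec_rearr B \<mu> i"
  then have *: "dec_rearr B \<mu> i < dec_rearr B \<mu> j" by simp
  then have pos: "0 < dec_rearr B \<mu> j" using dec_rearr_nonneg[of i] by linarith
  have "dec_rearr B \<mu> j \<le> dec_rearr B \<mu> i"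
    using le_dec_rearr_iff[OF pos, of i] le_dec_rearr_iff[OF pos, of j] ij by simp
  with * show False by simp
qed

text \<open>The indices with value \<open>t\<close> form the interval between the number of values
  above \<open>t\<close> and the number of values at least \<open>t\<close>.\<close>

lemma dec_rearr_fibre:
  assumes "0 < t"
  shows "finite {i. dec_rearr B \<mu> i = t}"
    and "card {i. dec_rearr B \<mu> i = t} = card {e\<in>B. \<mu> e = t}"
proof -
  have eq: "{i. dec_rearr B \<mu> i = t} = {card {e\<in>B. t < \<mu> e}..<card {e\<in>B. t \<le> \<mu> e}}"
    using le_dec_rearr_iff[OF assms] less_dec_rearr_iff[OF assms]
    by (auto simp: not_less order_antisym_conv order.antisym)
       (metis eq_iff less_dec_rearr_iff le_dec_rearr_iff not_le assms)+
  then show "finite {i. dec_rearr B \<mu> i = t}" by simp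
  have "{e\<in>B. t \<le> \<mu> e} = {e\<in>B. t < \<mu> e} \<union> {e\<in>B. \<mu> e = t}" by auto
  moreover have "finite {e\<in>B. t < \<mu> e}" "finite {e\<in>B. \<mu> e = t}"
    by (rule finite_subset[OF _ fin[OF assms]]; auto)+
  ultimately have "card {e\<in>B. t \<le> \<mu> e} = card {e\<in>B. t < \<mu> e} + card {e\<in>B. \<mu> e = t}"
    by (simp add: card_Un_disjoint disjoint_iff)
  then show "card {i. dec_rearr B \<mu> i = t} = card {e\<in>B. \<mu> e = t}" by (simp add: eq)
qed

text \<open>Over each positive \<open>t\<close> the two fibres are finite of equal size; the
  bijections \<open>h t\<close> are glued along the value. This later carries summability from the
  list of singular values to the eigenbasis.\<close>

lemma dec_rearr_bij:
  obtains g where "bij_betw g {i. 0 < dec_rearr B \<mu> i} {e\<in>B. 0 < \<mu> e}"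
    and "\<And>i. 0 < dec_rearr B \<mu> i \<Longrightarrow> \<mu> (g i) = dec_rearr B \<mu> i"
proof -
  have "\<exists>h. bij_betw h {i. dec_rearr B \<mu> i = t} {e\<in>B. \<mu> e = t}" if "0 < t" for t
    by (rule finite_same_card_bij)
       (use dec_rearr_fibre[OF that] in \<open>auto intro: finite_subset[OF _ fin[OF that]]\<close>)
  then obtain h where h: "\<And>t. 0 < t \<Longrightarrow> bij_betw (h t) {i. dec_rearr B \<mu> i = t} {e\<in>B. \<mu> e = t}"
    by metis
  define g where "g i = h (dec_rearr B \<mu> i) i" for i
  have g: "g i \<in> B \<and> \<mu> (g i) = dec_rearr B \<mu> i" if "0 < dec_rearr B \<mu> i" for i
    using h[OF that] unfolding g_def bij_betw_def by blast
  show ?thesis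
  proof (rule that[of g])
    show "bij_betw g {i. 0 < dec_rearr B \<mu> i} {e\<in>B. 0 < \<mu> e}"
      unfolding bij_betw_def
    proof (intro conjI inj_onI subset_antisym subsetI)
      fix i j assume "i \<in> {i. 0 < dec_rearr B \<mu> i}" "j \<in> {i. 0 < dec_rearr B \<mu> i}" "g i = g j"
      moreover from this have "dec_rearr B \<mu> i = dec_rearr B \<mu> j" using g by (metis mem_Collect_eq)
      ultimately show "i = j"
        using bij_betw_imp_inj_on[OF h[of "dec_rearr B \<mu> i"]] by (auto simp: g_def dest: inj_onD)
    next
      fix e assume "e \<in> g ` {i. 0 < dec_rearr B \<mu> i}"
      then show "e \<in> {e\<in>B. 0 < \<mu> e}" using g by auto
    next
      fix e assume e: "e \<in> {e\<in>B. 0 < \<mu> e}"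
      then have "e \<in> h (\<mu> e) ` {i. dec_rearr B \<mu> i = \<mu> e}"
        using bij_betw_imp_surj_on[OF h[of "\<mu> e"]] by auto
      then obtain i where "e = h (\<mu> e) i" "dec_rearr B \<mu> i = \<mu> e" by blast
      then show "e \<in> g ` {i. 0 < dec_rearr B \<mu> i}"
        using e by (intro image_eqI[of _ _ i]) (auto simp: g_def)
    qed
  qed (use g in blast)
qed

end

lemma decseq_eqI:
  fixes l l' :: "nat \<Rightarrow> real"
  assumes "decseq l" "decseq l'" and nonneg: "\<And>i. 0 \<le> l i" "\<And>i. 0 \<le> l' i"
    and fin: "\<And>t. 0 < t \<Longrightarrow> finite {i. l i = t}" "\<And>t. 0 < t \<Longrightarrow> finite {i. l' i = t}"
    and card: "\<And>t. 0 < t \<Longrightarrow> card {i. l i = t} = card {i. l' i = t}"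
  shows "l = l'"
proof -
  \<comment> \<open>At the first index of disagreement, the larger value occurs more often in its own sequence.\<close>
  have aux: "\<not> l' i < l i"
    if dec: "decseq l'" and nn: "\<And>i. 0 \<le> l' i"
      and fin: "\<And>t. 0 < t \<Longrightarrow> finite {i. l i = t}"
      and card: "\<And>t. 0 < t \<Longrightarrow> card {i. l i = t} = card {i. l' i = t}"
      and eq: "\<And>j. j < i \<Longrightarrow> l j = l' j" for l l' :: "nat \<Rightarrow> real" and i
  proof
    assume less: "l' i < l i"
    then have pos: "0 < l i" using nn[of i] by linarith
    have "{j. l' j = l i} \<subset> {j. l j = l i}"
    proof
      show "{j. l' j = l i} \<subseteq> {j. l j = l i}"
      proof safe
        fix j assume j: "l' j = l i"
        have "j < i"
        proof (rule ccontr)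
          assume "\<not> j < i"
          then have "l' j \<le> l' i" using dec by (simp add: decseq_def)
          with j less show False by simp
        qed
        with eq j show "l j = l i" by simp
      qed
      have "i \<notin> {j. l' j = l i}" "i \<in> {j. l j = l i}" using less by simp_all
      then show "{j. l' j = l i} \<noteq> {j. l j = l i}" by metis
    qed
    then have "card {j. l' j = l i} < card {j. l j = l i}"
      by (rule psubset_card_mono[OF fin[OF pos]])
    with card[OF pos] show False by simp
  qed
  have "l i = l' i" for i
  proof (induction i rule: less_induct)
    case (less i)
    have "\<not> l' i < l i" by (rule aux) (use assms less in auto)
    moreover have "\<not> l i < l' i" by (rule aux) (use assms less in auto)
    ultimately show ?case by simp
  qed
  then show ?thesis by blast
qed

section \<open>Convergence from moments\<close>

text \<open>\<open>f\<close> is bounded on the compact interval and the weights are nonnegative for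
  even \<open>q\<close>, so a constant multiple of \<open>\<mu> e ^ q\<close> dominates.\<close>

lemma summable_on_power_mult_continuous:
  fixes \<mu> :: "'a \<Rightarrow> real"
  assumes sum: "(\<lambda>e. \<mu> e ^ q) summable_on B" and "even q"
    and bd: "\<And>e. e \<in> B \<Longrightarrow> \<bar>\<mu> e\<bar> \<le> R"
    and f: "continuous_on {-R..R} f"
  shows "(\<lambda>e. \<mu> e ^ q * f (\<mu> e)) summable_on B"
proof -
  have "compact (f ` {-R..R})" by (intro compact_continuous_image f) simp
  then have "bounded (f ` {-R..R})" by (rule compact_imp_bounded)
  then obtain M where M: "\<forall>x\<in>{-R..R}. \<bar>f x\<bar> \<le> M" by (auto simp: bounded_iff)
  have "(\<lambda>e. \<bar>M\<bar> * \<mu> e ^ q) summable_on B" by (intro summable_on_cmult_right sum)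
  then have "(\<lambda>e. norm (\<mu> e ^ q * f (\<mu> e))) summable_on B"
  proof (rule summable_on_comparison_test)
    fix e assume "e \<in> B"
    then have "\<bar>f (\<mu> e)\<bar> \<le> \<bar>M\<bar>" using bspec[OF M, of "\<mu> e"] bd[of e] by (force simp: abs_le_iff)
    then show "norm (\<mu> e ^ q * f (\<mu> e)) \<le> \<bar>M\<bar> * \<mu> e ^ q"
      using \<open>even q\<close>
      by (simp add: abs_mult zero_le_even_power mult.commute[of "\<bar>M\<bar>"] mult_left_mono flip: power_abs)
  qed simp
  then show ?thesis using summable_on_iff_abs_summable_on_real by blast
qed

text \<open>Integration against the masses \<open>\<mu> e ^ q\<close> is Lipschitz in the uniform
  distance, with the total mass as constant. One approximation thus serves all \<open>k\<close> at
  once.\<close>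

lemma infsum_power_mult_diff_le:
  fixes \<mu> :: "'a \<Rightarrow> real"
  assumes sum: "(\<lambda>e. \<mu> e ^ q) summable_on B" and "even q"
    and bd: "\<And>e. e \<in> B \<Longrightarrow> \<bar>\<mu> e\<bar> \<le> R"
    and f: "continuous_on {-R..R} f" and g: "continuous_on {-R..R} g"
    and fg: "\<And>x. x \<in> {-R..R} \<Longrightarrow> \<bar>f x - g x\<bar> \<le> \<delta>"
  shows "\<bar>(\<Sum>\<^sub>\<infinity>e\<in>B. \<mu> e ^ q * f (\<mu> e)) - (\<Sum>\<^sub>\<infinity>e\<in>B. \<mu> e ^ q * g (\<mu> e))\<bar>
    \<le> \<delta> * (\<Sum>\<^sub>\<infinity>e\<in>B. \<mu> e ^ q)"
proof -
  note sg = summable_on_power_mult_continuous[OF sum \<open>even q\<close> bd g]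
  have cd: "continuous_on {-R..R} (\<lambda>x. f x - g x)" by (intro continuous_intros f g)
  have "norm (\<Sum>\<^sub>\<infinity>e\<in>B. \<mu> e ^ q * f (\<mu> e) - \<mu> e ^ q * g (\<mu> e)) \<le> (\<Sum>\<^sub>\<infinity>e\<in>B. \<delta> * \<mu> e ^ q)"
  proof (rule norm_infsum_le)
    show "((\<lambda>e. \<mu> e ^ q * f (\<mu> e) - \<mu> e ^ q * g (\<mu> e)) has_sum
        (\<Sum>\<^sub>\<infinity>e\<in>B. \<mu> e ^ q * f (\<mu> e) - \<mu> e ^ q * g (\<mu> e))) B"
      using summable_on_power_mult_continuous[OF sum \<open>even q\<close> bd cd]
      by (intro has_sum_infsum) (simp add: right_diff_distrib)
    show "((\<lambda>e. \<delta> * \<mu> e ^ q) has_sum (\<Sum>\<^sub>\<infinity>e\<in>B. \<delta> * \<mu> e ^ q)) B"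
      by (intro has_sum_infsum summable_on_cmult_right sum)
    fix e assume "e \<in> B"
    then have "\<bar>f (\<mu> e) - g (\<mu> e)\<bar> \<le> \<delta>" using fg[of "\<mu> e"] bd[of e] by (force simp: abs_le_iff)
    then have "\<mu> e ^ q * \<bar>f (\<mu> e) - g (\<mu> e)\<bar> \<le> \<mu> e ^ q * \<delta>"
      using \<open>even q\<close> by (intro mult_left_mono) auto
    then show "norm (\<mu> e ^ q * f (\<mu> e) - \<mu> e ^ q * g (\<mu> e)) \<le> \<delta> * \<mu> e ^ q"
      using \<open>even q\<close> by (simp add: abs_mult zero_le_even_power mult.commute[of \<delta>] flip: right_diff_distrib power_abs)
  qed
  moreover have "(\<Sum>\<^sub>\<infinity>e\<in>B. \<mu> e ^ q * f (\<mu> e)) = (\<Sum>\<^sub>\<infinity>e\<in>B. \<mu> e ^ q * g (\<mu> e))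
      + (\<Sum>\<^sub>\<infinity>e\<in>B. \<mu> e ^ q * f (\<mu> e) - \<mu> e ^ q * g (\<mu> e))"
    using infsum_add[OF sg summable_on_power_mult_continuous[OF sum \<open>even q\<close> bd cd]]
    by (simp add: right_diff_distrib)
  ultimately show ?thesis by (simp add: infsum_cmult_right')
qed

lemma has_sum_sum:
  fixes f :: "'i \<Rightarrow> 'a \<Rightarrow> 'b::topological_comm_monoid_add"
  assumes "\<And>i. i \<in> I \<Longrightarrow> (f i has_sum s i) A"
  shows "((\<lambda>x. \<Sum>i\<in>I. f i x) has_sum (\<Sum>i\<in>I. s i)) A"
  using assms by (induction I rule: infinite_finite_induct) (auto intro: has_sum_add)

text \<open>Polynomials only produce moments of order \<open>q + i\<close>, which stay in the range
  where convergence is assumed.\<close>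

lemma infsum_power_mult_polynomial:
  fixes \<mu> :: "'a \<Rightarrow> real"
  assumes sum: "(\<lambda>e. \<mu> e ^ q) summable_on B" and "even q"
    and bd: "\<And>e. e \<in> B \<Longrightarrow> \<bar>\<mu> e\<bar> \<le> R"
  shows "(\<Sum>\<^sub>\<infinity>e\<in>B. \<mu> e ^ q * (\<Sum>i\<le>n. a i * \<mu> e ^ i)) = (\<Sum>i\<le>n. a i * (\<Sum>\<^sub>\<infinity>e\<in>B. \<mu> e ^ (q + i)))"
proof -
  have "(\<lambda>e. \<mu> e ^ q * \<mu> e ^ i) summable_on B" for i
    by (rule summable_on_power_mult_continuous[OF sum \<open>even q\<close> bd])
       (auto intro!: continuous_intros)
  then have "((\<lambda>e. \<Sum>i\<le>n. a i * (\<mu> e ^ q * \<mu> e ^ i)) has_sum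
      (\<Sum>i\<le>n. a i * (\<Sum>\<^sub>\<infinity>e\<in>B. \<mu> e ^ q * \<mu> e ^ i))) B"
    by (intro has_sum_sum has_sum_cmult_right has_sum_infsum) auto
  then show ?thesis
    by (auto dest!: infsumI simp: power_add sum_distrib_left algebra_simps)
qed

text \<open>Polynomial approximation needs two uniformities in \<open>k\<close>: one interval that
  contains all values, and one bound on the total masses. The latter comes from the convergence of
  the moment of order \<open>q\<close>.\<close>

lemma tendsto_infsum_power_mult_continuous:
  fixes \<mu> :: "'a \<Rightarrow> real" and \<nu> :: "nat \<Rightarrow> 'b \<Rightarrow> real"
  assumes "even q"
    and sum: "(\<lambda>e. \<mu> e ^ q) summable_on B" "\<And>k. (\<lambda>e. \<nu> k e ^ q) summable_on C k"
    and bd: "\<And>e. e \<in> B \<Longrightarrow> \<bar>\<mu> e\<bar> \<le> R" "\<And>k e. e \<in> C k \<Longrightarrow> \<bar>\<nu> k e\<bar> \<le> R"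
    and lim: "\<And>n. n \<ge> q \<Longrightarrow> (\<lambda>k. \<Sum>\<^sub>\<infinity>e\<in>C k. \<nu> k e ^ n) \<longlonglongrightarrow> (\<Sum>\<^sub>\<infinity>e\<in>B. \<mu> e ^ n)"
    and f: "continuous_on {-R..R} f"
  shows "(\<lambda>k. \<Sum>\<^sub>\<infinity>e\<in>C k. \<nu> k e ^ q * f (\<nu> k e)) \<longlonglongrightarrow> (\<Sum>\<^sub>\<infinity>e\<in>B. \<mu> e ^ q * f (\<mu> e))"
proof -
  define S where "S g = (\<Sum>\<^sub>\<infinity>e\<in>B. \<mu> e ^ q * g (\<mu> e))" for g
  define Sk where "Sk k g = (\<Sum>\<^sub>\<infinity>e\<in>C k. \<nu> k e ^ q * g (\<nu> k e))" for k g
  have cont: "continuous_on {-R..R} (\<lambda>x. \<Sum>i\<le>n. a i * x ^ i)" for a :: "nat \<Rightarrow> real" and n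
    by (intro continuous_intros)
  have poly: "(\<lambda>k. Sk k (\<lambda>x. \<Sum>i\<le>n. a i * x ^ i)) \<longlonglongrightarrow> S (\<lambda>x. \<Sum>i\<le>n. a i * x ^ i)"
    for a :: "nat \<Rightarrow> real" and n
  proof -
    show ?thesis
      unfolding S_def Sk_def
      by (subst (1 2) infsum_power_mult_polynomial[where R = R];
          (intro tendsto_intros lim)?; simp add: sum bd \<open>even q\<close>)
  qed
  have "convergent (\<lambda>k. \<Sum>\<^sub>\<infinity>e\<in>C k. \<nu> k e ^ q)" using lim[of q] by (auto simp: convergent_def)
  then have "Bseq (\<lambda>k. \<Sum>\<^sub>\<infinity>e\<in>C k. \<nu> k e ^ q)" by (rule convergent_imp_Bseq)
  then obtain K where K: "\<And>k. \<bar>\<Sum>\<^sub>\<infinity>e\<in>C k. \<nu> k e ^ q\<bar> \<le> K" by (auto simp: Bseq_def)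
  define M where "M = max 1 (max K (\<Sum>\<^sub>\<infinity>e\<in>B. \<mu> e ^ q))"
  have M: "0 < M" "(\<Sum>\<^sub>\<infinity>e\<in>B. \<mu> e ^ q) \<le> M" "\<And>k. (\<Sum>\<^sub>\<infinity>e\<in>C k. \<nu> k e ^ q) \<le> M"
    using K by (auto simp: M_def le_max_iff_disj abs_le_iff)
  have "(\<lambda>k. Sk k f) \<longlonglongrightarrow> S f"
  proof (rule LIMSEQ_I)
    fix \<epsilon> :: real assume "0 < \<epsilon>"
    \<comment> \<open>\<open>M\<close> is positive thanks to the \<open>1\<close> in its definition.
      Three errors of at most \<open>\<epsilon> / 4\<close> leave the total strictly below
      \<open>\<epsilon>\<close>.\<close>
    define \<delta> where "\<delta> = \<epsilon> / (4 * M)"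
    have \<delta>: "0 < \<delta>" "\<delta> * M = \<epsilon> / 4" using \<open>0 < \<epsilon>\<close> M(1) by (auto simp: \<delta>_def)
    obtain g where "real_polynomial_function g" and g: "\<And>x. x \<in> {-R..R} \<Longrightarrow> \<bar>f x - g x\<bar> < \<delta>"
      using Stone_Weierstrass_real_polynomial_function[OF _ f \<delta>(1)] by auto
    then obtain a n where gp: "g = (\<lambda>x. \<Sum>i\<le>n. a i * x ^ i)"
      by (auto simp: real_polynomial_function_iff_sum)
    note cg = cont[of a n, folded gp]
    obtain N where N: "\<And>k. k \<ge> N \<Longrightarrow> \<bar>Sk k g - S g\<bar> < \<epsilon> / 4"
      using LIMSEQ_D[OF poly[of a n, folded gp], of "\<epsilon>/4"] \<open>0 < \<epsilon>\<close> by auto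
    have "\<bar>S f - S g\<bar> \<le> \<delta> * (\<Sum>\<^sub>\<infinity>e\<in>B. \<mu> e ^ q)"
      unfolding S_def using g by (intro infsum_power_mult_diff_le[where R = R] sum bd f cg) (auto simp: \<open>even q\<close> less_imp_le)
    also have "\<dots> \<le> \<epsilon> / 4" using mult_left_mono[OF M(2), of \<delta>] \<delta> by simp
    finally have 1: "\<bar>S f - S g\<bar> \<le> \<epsilon> / 4" .
    have 2: "\<bar>Sk k f - Sk k g\<bar> \<le> \<epsilon> / 4" for k
    proof -
      have "\<bar>Sk k f - Sk k g\<bar> \<le> \<delta> * (\<Sum>\<^sub>\<infinity>e\<in>C k. \<nu> k e ^ q)"
        unfolding Sk_def using g by (intro infsum_power_mult_diff_le[where R = R] sum bd f cg) (auto simp: \<open>even q\<close> less_imp_le)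
      also have "\<dots> \<le> \<epsilon> / 4" using mult_left_mono[OF M(3)[of k], of \<delta>] \<delta> by simp
      finally show ?thesis .
    qed
    have "\<bar>Sk k f - S f\<bar> < \<epsilon>" if "k \<ge> N" for k
      using 1 2[of k] N[OF that] \<open>0 < \<epsilon>\<close> by (simp only: abs_le_iff abs_less_iff) linarith
    then show "\<exists>N. \<forall>k\<ge>N. norm (Sk k f - S f) < \<epsilon>" by auto
  qed
  then show ?thesis by (simp add: S_def Sk_def)
qed

section \<open>Counting eigenvalues with continuous test functions\<close>

definition ramp :: "real \<Rightarrow> real \<Rightarrow> real \<Rightarrow> real" where
  "ramp s t x = max 0 (min 1 ((x - s) / (t - s)))"

lemma ramp_eq_0: "s < t \<Longrightarrow> x \<le> s \<Longrightarrow> ramp s t x = 0"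
  using divide_nonpos_pos[of "x - s" "t - s"] by (simp add: ramp_def max_def min_def)

lemma ramp_eq_1: "s < t \<Longrightarrow> t \<le> x \<Longrightarrow> ramp s t x = 1"
  by (simp add: ramp_def)

lemma ramp_nonneg: "0 \<le> ramp s t x" and ramp_le_1: "ramp s t x \<le> 1"
  by (simp_all add: ramp_def)

text \<open>The ramp lies between the indicators of \<open>{t..}\<close> and \<open>{s<..}\<close>,
  so its sum is a continuous substitute for a count.\<close>

lemma ramp_infsum_bounds:
  fixes \<mu> :: "'a \<Rightarrow> real"
  assumes fin: "\<And>t. 0 < t \<Longrightarrow> finite {e\<in>B. t \<le> \<mu> e}" and st: "0 < s" "s < t"
  shows "real (card {e\<in>B. t \<le> \<mu> e}) \<le> (\<Sum>\<^sub>\<infinity>e\<in>B. ramp s t (\<mu> e))"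
    and "(\<Sum>\<^sub>\<infinity>e\<in>B. ramp s t (\<mu> e)) \<le> real (card {e\<in>B. s < \<mu> e})"
proof -
  have fs: "finite {e\<in>B. s < \<mu> e}" by (rule finite_subset[OF _ fin[OF st(1)]]) auto
  have "(\<Sum>\<^sub>\<infinity>e\<in>B. ramp s t (\<mu> e)) = (\<Sum>\<^sub>\<infinity>e\<in>{e\<in>B. s < \<mu> e}. ramp s t (\<mu> e))"
    by (rule infsum_cong_neutral)
       (use ramp_eq_0[OF st(2)] in auto)
  also have "\<dots> = (\<Sum>e\<in>{e\<in>B. s < \<mu> e}. ramp s t (\<mu> e))" using fs by simp
  finally have eq: "(\<Sum>\<^sub>\<infinity>e\<in>B. ramp s t (\<mu> e)) = (\<Sum>e\<in>{e\<in>B. s < \<mu> e}. ramp s t (\<mu> e))" .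
  have "(\<Sum>e\<in>{e\<in>B. s < \<mu> e}. ramp s t (\<mu> e)) \<le> (\<Sum>e\<in>{e\<in>B. s < \<mu> e}. 1)"
    by (intro sum_mono ramp_le_1)
  then show "(\<Sum>\<^sub>\<infinity>e\<in>B. ramp s t (\<mu> e)) \<le> real (card {e\<in>B. s < \<mu> e})" by (simp add: eq)
  have "real (card {e\<in>B. t \<le> \<mu> e}) = (\<Sum>e\<in>{e\<in>B. t \<le> \<mu> e}. ramp s t (\<mu> e))"
    using ramp_eq_1[OF st(2)] by simp
  also have "\<dots> \<le> (\<Sum>e\<in>{e\<in>B. s < \<mu> e}. ramp s t (\<mu> e))"
    using st fs by (intro sum_mono2) (auto simp: ramp_nonneg)
  finally show "real (card {e\<in>B. t \<le> \<mu> e}) \<le> (\<Sum>\<^sub>\<infinity>e\<in>B. ramp s t (\<mu> e))" by (simp add: eq)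
qed

text \<open>On the level set the sum dominates the positive constant \<open>t ^ p\<close>, which is
  summable only over a finite set.\<close>

lemma abs_summable_power_finite:
  fixes \<mu> :: "'a \<Rightarrow> real"
  assumes sum: "(\<lambda>e. \<bar>\<mu> e\<bar> ^ p) summable_on B" and "0 < t"
  shows "finite {e\<in>B. t \<le> \<mu> e}"
proof -
  have "(\<lambda>e. \<bar>\<mu> e\<bar> ^ p) summable_on {e\<in>B. t \<le> \<mu> e}"
    by (rule summable_on_subset_banach[OF sum]) auto
  then have "(\<lambda>e. t ^ p) summable_on {e\<in>B. t \<le> \<mu> e}"
    by (rule summable_on_comparison_test) (use \<open>0 < t\<close> in \<open>auto intro!: power_mono\<close>)
  then show ?thesis using \<open>0 < t\<close> infsum_diverge_constant[of "{e\<in>B. t \<le> \<mu> e}" "t ^ p"] by auto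
qed

text \<open>Only finitely many values have modulus at least \<open>1\<close>; for the others powers
  decrease in the exponent.\<close>

lemma abs_power_summable_higher:
  fixes \<mu> :: "'a \<Rightarrow> real"
  assumes sum: "(\<lambda>e. \<bar>\<mu> e\<bar> ^ p) summable_on B" and "p \<le> n"
  shows "(\<lambda>e. \<bar>\<mu> e\<bar> ^ n) summable_on B"
proof -
  let ?F = "{e\<in>B. 1 \<le> \<bar>\<mu> e\<bar>}"
  have "finite ?F" using abs_summable_power_finite[of "\<lambda>e. \<bar>\<mu> e\<bar>" p B 1] sum by simp
  then have 1: "(\<lambda>e. \<bar>\<mu> e\<bar> ^ n) summable_on ?F" by simp
  have "(\<lambda>e. \<bar>\<mu> e\<bar> ^ p) summable_on (B - ?F)"
    by (rule summable_on_subset_banach[OF sum]) auto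
  then have 2: "(\<lambda>e. \<bar>\<mu> e\<bar> ^ n) summable_on (B - ?F)"
    by (rule summable_on_comparison_test) (auto intro!: power_decreasing \<open>p \<le> n\<close>)
  have "B = ?F \<union> (B - ?F)" by auto
  with summable_on_Un_disjoint[OF 1 2] show ?thesis by auto
qed

text \<open>A single nonnegative term is at most the sum. A modulus beyond \<open>R \<ge> 1\<close>
  is at most its own \<open>q\<close>-th power, so the mass bound doubles as a bound on the values
  without taking roots.\<close>

lemma abs_le_of_infsum_power_le:
  fixes \<mu> :: "'a \<Rightarrow> real"
  assumes sum: "(\<lambda>e. \<mu> e ^ q) summable_on B" "(\<Sum>\<^sub>\<infinity>e\<in>B. \<mu> e ^ q) \<le> R"
    and q: "even q" "0 < q" and "1 \<le> R" "e \<in> B"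
  shows "\<bar>\<mu> e\<bar> \<le> R"
proof (rule ccontr)
  assume "\<not> \<bar>\<mu> e\<bar> \<le> R"
  then have R: "R < \<bar>\<mu> e\<bar>" by simp
  have "\<bar>\<mu> e\<bar> \<le> \<bar>\<mu> e\<bar> ^ q" using R \<open>1 \<le> R\<close> q by (intro self_le_power) auto
  also have "\<dots> = (\<Sum>\<^sub>\<infinity>e\<in>{e}. \<mu> e ^ q)" using power_even_abs[OF q(1)] by simp
  also have "\<dots> \<le> (\<Sum>\<^sub>\<infinity>e\<in>B. \<mu> e ^ q)"
    by (rule infsum_mono2) (use sum q \<open>e \<in> B\<close> in \<open>auto simp: zero_le_even_power\<close>)
  finally show False using sum(2) R by simp
qed

text \<open>Comparing an entry with a threshold is an integer inequality between an index and a
  count. Ramp sums turn it into a strict inequality between reals, which passes from the limit to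
  all large \<open>k\<close>.\<close>

lemma dec_rearr_tendsto:
  fixes \<mu> :: "'a \<Rightarrow> real" and \<nu> :: "nat \<Rightarrow> 'b \<Rightarrow> real"
  assumes sum: "(\<lambda>e. \<bar>\<mu> e\<bar> ^ p) summable_on B" "\<And>k. (\<lambda>e. \<bar>\<nu> k e\<bar> ^ p) summable_on C k"
    and "1 \<le> p"
    and lim: "\<And>n. n \<ge> p \<Longrightarrow> (\<lambda>k. \<Sum>\<^sub>\<infinity>e\<in>C k. \<nu> k e ^ n) \<longlonglongrightarrow> (\<Sum>\<^sub>\<infinity>e\<in>B. \<mu> e ^ n)"
  shows "(\<lambda>k. dec_rearr (C k) (\<nu> k) i) \<longlonglongrightarrow> dec_rearr B \<mu> i"
proof -
  \<comment> \<open>Doubling gives an even exponent that is at least \<open>p\<close>, and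
    \<open>p \<ge> 1\<close> makes it positive.\<close>
  define q where "q = 2 * p"
  have q: "even q" "p \<le> q" "0 < q" using \<open>1 \<le> p\<close> by (auto simp: q_def)
  have sq: "(\<lambda>e. \<mu> e ^ q) summable_on B" "\<And>k. (\<lambda>e. \<nu> k e ^ q) summable_on C k"
    using abs_power_summable_higher[OF sum(1) q(2)] abs_power_summable_higher[OF sum(2) q(2)]
    by (simp_all add: power_even_abs[OF q(1)])
  note fB = abs_summable_power_finite[OF sum(1)] and fC = abs_summable_power_finite[OF sum(2)]
  have "convergent (\<lambda>k. \<Sum>\<^sub>\<infinity>e\<in>C k. \<nu> k e ^ q)" using lim[of q] q by (auto simp: convergent_def)
  then have "Bseq (\<lambda>k. \<Sum>\<^sub>\<infinity>e\<in>C k. \<nu> k e ^ q)" by (rule convergent_imp_Bseq)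
  then obtain K where K: "\<And>k. \<bar>\<Sum>\<^sub>\<infinity>e\<in>C k. \<nu> k e ^ q\<bar> \<le> K" by (auto simp: Bseq_def)
  \<comment> \<open>One constant bounds the masses and, through
    \<open>abs_le_of_infsum_power_le\<close>, all the values; the \<open>1\<close> is required
    there.\<close>
  define R where "R = max 1 (max K (\<Sum>\<^sub>\<infinity>e\<in>B. \<mu> e ^ q))"
  have R: "(\<Sum>\<^sub>\<infinity>e\<in>B. \<mu> e ^ q) \<le> R" "\<And>k. (\<Sum>\<^sub>\<infinity>e\<in>C k. \<nu> k e ^ q) \<le> R" "1 \<le> R"
    using K by (auto simp: R_def le_max_iff_disj abs_le_iff)
  have ramp_lim: "(\<lambda>k. \<Sum>\<^sub>\<infinity>e\<in>C k. ramp s t (\<nu> k e)) \<longlonglongrightarrow> (\<Sum>\<^sub>\<infinity>e\<in>B. ramp s t (\<mu> e))"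
    if st: "0 < s" "s < t" for s t
  proof -
    \<comment> \<open>This is \<open>ramp s t x / x ^ q\<close>, since the ramp vanishes for \<open>x \<le> s\<close>, but continuous on the whole line.\<close>
    let ?f = "\<lambda>x. ramp s t x / (max x s) ^ q"
    have eq: "x ^ q * ?f x = ramp s t x" for x
    proof (cases "x \<le> s")
      case True
      with st show ?thesis by (simp add: ramp_eq_0)
    next
      case False
      with st show ?thesis by (simp add: max_def)
    qed
    have "continuous_on {-R..R} ?f"
      unfolding ramp_def using st by (intro continuous_intros) (auto simp: max_def)
    then have "(\<lambda>k. \<Sum>\<^sub>\<infinity>e\<in>C k. \<nu> k e ^ q * ?f (\<nu> k e)) \<longlonglongrightarrow> (\<Sum>\<^sub>\<infinity>e\<in>B. \<mu> e ^ q * ?f (\<mu> e))"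
      using q by (intro tendsto_infsum_power_mult_continuous[where R = R] sq lim
          abs_le_of_infsum_power_le[OF sq(1)] abs_le_of_infsum_power_le[OF sq(2)] R) auto
    then show ?thesis by (simp only: eq)
  qed
  show ?thesis
  proof (rule order_tendstoI)
    fix s assume s: "s < dec_rearr B \<mu> i"
    show "\<forall>\<^sub>F k in sequentially. s < dec_rearr (C k) (\<nu> k) i"
    proof (cases "s < 0")
      case True
      then show ?thesis using dec_rearr_nonneg[OF fC] by (auto intro: less_le_trans always_eventually)
    next
      case False
      \<comment> \<open>More than \<open>i\<close> values reach \<open>dec_rearr B \<mu> i\<close>,
        so the ramp from \<open>u\<close> up to this entry has sum above \<open>i\<close> over
        \<open>B\<close>. For large \<open>k\<close> the same bound over \<open>C k\<close> forces
        more than \<open>i\<close> values above \<open>u\<close>.\<close>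
      define u where "u = (s + dec_rearr B \<mu> i) / 2"
      have u: "s < u" "u < dec_rearr B \<mu> i" "0 < u" using s False by (auto simp: u_def)
      have "i < card {e\<in>B. dec_rearr B \<mu> i \<le> \<mu> e}"
        using le_dec_rearr_iff[OF fB, of "dec_rearr B \<mu> i" i] u by simp
      then have "real i < (\<Sum>\<^sub>\<infinity>e\<in>B. ramp u (dec_rearr B \<mu> i) (\<mu> e))"
        using ramp_infsum_bounds(1)[OF fB u(3,2)] by simp
      then have "\<forall>\<^sub>F k in sequentially. real i < (\<Sum>\<^sub>\<infinity>e\<in>C k. ramp u (dec_rearr B \<mu> i) (\<nu> k e))"
        by (rule order_tendstoD(1)[OF ramp_lim[OF u(3,2)]])
      then show ?thesis
      proof eventually_elim
        case (elim k)
        also note ramp_infsum_bounds(2)[OF fC u(3,2)]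
        finally have "u < dec_rearr (C k) (\<nu> k) i" using less_dec_rearr_iff[OF fC u(3)] by simp
        with u show ?case by simp
      qed
    qed
  next
    fix s assume s: "dec_rearr B \<mu> i < s"
    define u where "u = (s + dec_rearr B \<mu> i) / 2"
    have u: "u < s" "dec_rearr B \<mu> i < u" using s by (auto simp: u_def)
    have u0: "0 < u" using u dec_rearr_nonneg[OF fB, of i] by linarith
    have "\<not> i < card {e\<in>B. u < \<mu> e}"
      using less_dec_rearr_iff[OF fB u0, of i] u by simp
    \<comment> \<open>The sum is at most \<open>i\<close>, and comparing with \<open>i + 1\<close>
      leaves room for the limit: a count below \<open>i + 1\<close> is still at most
      \<open>i\<close>.\<close>
    then have "(\<Sum>\<^sub>\<infinity>e\<in>B. ramp u s (\<mu> e)) < real i + 1"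
      using ramp_infsum_bounds(2)[OF fB u0 u(1)] by simp
    then have "\<forall>\<^sub>F k in sequentially. (\<Sum>\<^sub>\<infinity>e\<in>C k. ramp u s (\<nu> k e)) < real i + 1"
      by (rule order_tendstoD(2)[OF ramp_lim[OF u0 u(1)]])
    then show "\<forall>\<^sub>F k in sequentially. dec_rearr (C k) (\<nu> k) i < s"
    proof eventually_elim
      case (elim k)
      have "real (card {e\<in>C k. s \<le> \<nu> k e}) < real i + 1"
        using ramp_infsum_bounds(1)[OF fC u0 u(1), of k] elim by simp
      then have "\<not> i < card {e\<in>C k. s \<le> \<nu> k e}" by linarith
      then show ?case using le_dec_rearr_iff[OF fC, of s k i] u u0 by simp
    qed
  qed
qed

section \<open>Diagonalization of compact selfadjoint operators\<close>

text \<open>The condition is stated weakly so that no operator is ever applied to an infinite sum of vectors.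
  Since \<open>\<mu>\<close> is real, it says that the elements of \<open>B\<close> are eigenvectors and \<open>A\<close> is symmetric.\<close>

definition diagonalizes :: "('a, 'm) inner_space_scheme \<Rightarrow> ('a \<Rightarrow> 'a) \<Rightarrow> 'a set \<Rightarrow> ('a \<Rightarrow> real) \<Rightarrow> bool" where
  "diagonalizes H A B \<mu> \<longleftrightarrow> orthonormal_basis H (carrier H) B \<and>
    (\<forall>x\<in>carrier H. A x \<in> carrier H \<and>
      (\<forall>e\<in>B. inner_prod H (A x) e = of_real (\<mu> e) * inner_prod H x e))"

lemma diagonalizes_comp:
  assumes "diagonalizes H A B \<mu>" "diagonalizes H A' B \<nu>"
  shows "diagonalizes H (A \<circ> A') B (\<lambda>e. \<mu> e * \<nu> e)"
  using assms by (simp add: diagonalizes_def)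

lemma diagonalizes_funpow:
  assumes "diagonalizes H A B \<mu>"
  shows "diagonalizes H (A ^^ n) B (\<lambda>e. \<mu> e ^ n)"
proof (induction n)
  case 0
  then show ?case using assms by (simp add: diagonalizes_def)
next
  case (Suc n)
  then show ?case using diagonalizes_comp[OF assms Suc] by (simp only: funpow.simps power_Suc)
qed

section \<open>Inner product identities\<close>

context complex_inner_space
begin

lemma inner_diff_left:
  "\<lbrakk>x \<in> carrier H; y \<in> carrier H; z \<in> carrier H\<rbrakk> \<Longrightarrow>
    inner_prod H (x \<ominus> y) z = inner_prod H x z - inner_prod H y z"
  by (simp add: a_minus_def minus_conv_smult inner_add_left inner_scale_left)

lemma inner_diff_right:
  "\<lbrakk>x \<in> carrier H; y \<in> carrier H; z \<in> carrier H\<rbrakk> \<Longrightarrow>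
    inner_prod H x (y \<ominus> z) = inner_prod H x y - inner_prod H x z"
  by (simp add: a_minus_def minus_conv_smult inner_add_right inner_scale_right)

text \<open>Tested on \<open>z = x \<ominus> y\<close>. Vector identities are checked this way
  below, since linearity reduces them to complex arithmetic.\<close>

lemma inner_eqI:
  assumes "x \<in> carrier H" "y \<in> carrier H"
    and "\<And>z. z \<in> carrier H \<Longrightarrow> inner_prod H x z = inner_prod H y z"
  shows "x = y"
proof -
  have "inner_prod H (x \<ominus> y) (x \<ominus> y) = 0"
    using assms(3)[of "x \<ominus> y"] assms(1,2) by (simp add: inner_diff_left)
  then have "hnorm H (x \<ominus> y) = 0" by (simp add: hnorm_def)
  then have "hdist H x y = 0" using assms by (simp add: hdist_def)
  then show ?thesis using assms by simp
qed

lemma hnorm_diff_square: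
  "\<lbrakk>x \<in> carrier H; y \<in> carrier H\<rbrakk> \<Longrightarrow>
    (hnorm H (x \<ominus> y))\<^sup>2 = (hnorm H x)\<^sup>2 - 2 * Re (inner_prod H x y) + (hnorm H y)\<^sup>2"
  using inner_commute[of x y] by (simp add: hnorm_square inner_diff_left inner_diff_right)

lemma hnorm_scale: "x \<in> carrier H \<Longrightarrow> hnorm H (c \<odot> x) = cmod c * hnorm H x"
proof -
  assume x: "x \<in> carrier H"
  have "inner_prod H (c \<odot> x) (c \<odot> x) = (c * cnj c) * inner_prod H x x"
    using x by (simp add: inner_scale_left inner_scale_right)
  also have "c * cnj c = of_real ((cmod c)\<^sup>2)" by (rule complex_norm_square[symmetric])
  finally have "Re (inner_prod H (c \<odot> x) (c \<odot> x)) = (cmod c)\<^sup>2 * Re (inner_prod H x x)"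
    by (simp del: of_real_power)
  then show ?thesis by (simp add: hnorm_def real_sqrt_mult)
qed

text \<open>The difference is orthogonal to all of \<open>B\<close>, so maximality makes it zero:
  Fourier coefficients determine the vector.\<close>

lemma orthonormal_basis_eqI:
  assumes B: "orthonormal_basis H (carrier H) B" and "x \<in> carrier H" "y \<in> carrier H"
    and "\<And>e. e \<in> B \<Longrightarrow> inner_prod H x e = inner_prod H y e"
  shows "x = y"
proof -
  have "B \<subseteq> carrier H" using B by (simp add: orthonormal_basis_def)
  then have "\<forall>e\<in>B. inner_prod H (x \<ominus> y) e = 0" using assms(2-4) by (auto simp: inner_diff_left)
  then have "x \<ominus> y = \<zero>" using B assms(2,3) by (simp add: orthonormal_basis_def)
  then have "hdist H x y = 0" using assms(2,3) by (simp add: hdist_def hnorm_eq_0)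
  then show ?thesis using assms(2,3) by simp
qed

lemma inner_finsum_left:
  assumes "finite F" "g \<in> F \<rightarrow> carrier H" "z \<in> carrier H"
  shows "inner_prod H (finsum H g F) z = (\<Sum>e\<in>F. inner_prod H (g e) z)"
  using assms
proof (induction F)
  case empty
  then show ?case by (simp add: inner_zero_left)
next
  case (insert e F)
  then have "g \<in> F \<rightarrow> carrier H" "g e \<in> carrier H" by auto
  with insert show ?case by (simp add: M.finsum_insert inner_add_left M.finsum_closed)
qed

section \<open>Finite orthogonal projections and the Bessel inequality\<close>

definition orthonormal :: "'a set \<Rightarrow> bool" where
  "orthonormal B \<longleftrightarrow> B \<subseteq> carrier H \<and>
    (\<forall>e\<in>B. \<forall>f\<in>B. inner_prod H e f = (if e = f then 1 else 0))"

lemma orthonormal_subset: "orthonormal B \<Longrightarrow> F \<subseteq> B \<Longrightarrow> orthonormal F"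
  unfolding orthonormal_def by blast

lemma orthonormal_basis_imp_orthonormal:
  "orthonormal_basis H (carrier H) B \<Longrightarrow> orthonormal B"
  by (simp add: orthonormal_basis_def orthonormal_def)

text \<open>For finite orthonormal \<open>F\<close> this is the orthogonal projection onto the span
  of \<open>F\<close>, a partial Fourier sum.\<close>

definition proj :: "'a set \<Rightarrow> 'a \<Rightarrow> 'a" where
  "proj F x = finsum H (\<lambda>e. inner_prod H x e \<odot> e) F"

lemma proj_closed [simp]: "F \<subseteq> carrier H \<Longrightarrow> proj F x \<in> carrier H"
  unfolding proj_def by (rule M.finsum_closed) auto

lemma inner_proj_left:
  assumes "finite F" "F \<subseteq> carrier H" "z \<in> carrier H"
  shows "inner_prod H (proj F x) z = (\<Sum>e\<in>F. inner_prod H x e * inner_prod H e z)"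
  unfolding proj_def
  by (subst inner_finsum_left) (use assms in \<open>auto simp: inner_scale_left subset_iff intro!: sum.cong\<close>)

lemma inner_proj_member:
  assumes "finite F" "F \<subseteq> B" "orthonormal B" "e \<in> B"
  shows "inner_prod H (proj F x) e = (if e \<in> F then inner_prod H x e else 0)"
proof -
  have "inner_prod H (proj F x) e = (\<Sum>f\<in>F. inner_prod H x f * inner_prod H f e)"
    by (rule inner_proj_left) (use assms in \<open>auto simp: orthonormal_def\<close>)
  also have "\<dots> = (\<Sum>f\<in>F. if f = e then inner_prod H x f else 0)"
    by (rule sum.cong) (use assms in \<open>auto simp: orthonormal_def subset_iff\<close>)
  finally show ?thesis using assms(1) by simp
qed

text \<open>The nested case turns distances of partial Fourier sums into differences of coefficient
  sums, which gives the Cauchy property; the second identity gives Pythagoras.\<close>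

lemma inner_proj_proj:
  assumes F: "finite F" "F \<subseteq> G" "finite G" and G: "orthonormal G" and x: "x \<in> carrier H"
  shows "inner_prod H (proj F x) (proj G x) = of_real (\<Sum>e\<in>F. (cmod (inner_prod H x e))\<^sup>2)"
    and "inner_prod H (proj F x) x = of_real (\<Sum>e\<in>F. (cmod (inner_prod H x e))\<^sup>2)"
proof -
  have GH: "G \<subseteq> carrier H" using G by (simp add: orthonormal_def)
  have FH: "F \<subseteq> carrier H" using GH F by simp
  have *: "inner_prod H e (proj G x) = cnj (inner_prod H x e)" if "e \<in> F" for e
  proof -
    have "e \<in> G" "e \<in> carrier H" using that F GH by auto
    then show ?thesis
      using inner_commute[of "proj G x" e] inner_proj_member[OF F(3) order_refl G, of e x] GH by simp
  qed
  show "inner_prod H (proj F x) (proj G x) = of_real (\<Sum>e\<in>F. (cmod (inner_prod H x e))\<^sup>2)"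
    by (subst inner_proj_left[OF F(1) FH])
       (use GH in \<open>simp_all add: * complex_norm_square del: of_real_power\<close>)
  have "inner_prod H e x = cnj (inner_prod H x e)" if "e \<in> F" for e
    using inner_commute[of x e] x that FH by auto
  then show "inner_prod H (proj F x) x = of_real (\<Sum>e\<in>F. (cmod (inner_prod H x e))\<^sup>2)"
    by (simp add: inner_proj_left[OF F(1) FH x] complex_norm_square del: of_real_power)
qed

lemma hnorm_diff_proj:
  assumes F: "finite F" "orthonormal F" and x: "x \<in> carrier H"
  shows "(hnorm H (x \<ominus> proj F x))\<^sup>2 = (hnorm H x)\<^sup>2 - (\<Sum>e\<in>F. (cmod (inner_prod H x e))\<^sup>2)"
proof -
  have FH: "F \<subseteq> carrier H" using F by (simp add: orthonormal_def)
  note pp = inner_proj_proj[OF F(1) order_refl F x]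
  have "inner_prod H x (proj F x) = of_real (\<Sum>e\<in>F. (cmod (inner_prod H x e))\<^sup>2)"
    using inner_commute[of "proj F x" x] x FH pp(2) by simp
  then show ?thesis using x FH pp(1) by (simp add: hnorm_diff_square hnorm_square[of "proj F x"])
qed

lemma Bessel:
  assumes "finite F" "orthonormal F" "x \<in> carrier H"
  shows "(\<Sum>e\<in>F. (cmod (inner_prod H x e))\<^sup>2) \<le> (hnorm H x)\<^sup>2"
  using hnorm_diff_proj[OF assms] by (metis diff_ge_0_iff_ge zero_le_power2)

section \<open>Norm convergence and the Parseval identities\<close>

lemma tendsto_inner:
  assumes lim: "(\<lambda>n. hnorm H (u n \<ominus> y)) \<longlonglongrightarrow> 0"
    and u: "\<And>n. u n \<in> carrier H" and y: "y \<in> carrier H" and z: "z \<in> carrier H"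
  shows "(\<lambda>n. inner_prod H (u n) z) \<longlonglongrightarrow> inner_prod H y z"
proof -
  have "(\<lambda>n. inner_prod H (u n) z - inner_prod H y z) \<longlonglongrightarrow> 0"
  proof (rule Lim_null_comparison[OF always_eventually])
    show "\<forall>n. norm (inner_prod H (u n) z - inner_prod H y z) \<le> hnorm H (u n \<ominus> y) * hnorm H z"
      using Cauchy_Schwarz[of "u _ \<ominus> y" z] u y z by (simp add: inner_diff_left)
    show "(\<lambda>n. hnorm H (u n \<ominus> y) * hnorm H z) \<longlonglongrightarrow> 0"
      using tendsto_mult_right[OF lim, of "hnorm H z"] by simp
  qed
  then show ?thesis by (simp add: LIM_zero_iff)
qed

lemma limitin_imp_hnorm_tendsto:
  assumes "limitin (norm_topology H) u y sequentially" "\<And>n. u n \<in> carrier H"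
  shows "y \<in> carrier H" "(\<lambda>n. hnorm H (u n \<ominus> y)) \<longlonglongrightarrow> 0"
proof -
  show y: "y \<in> carrier H" using assms(1) by (simp add: metric.limitin_metric)
  have "(\<lambda>n. hdist H (u n) y) \<longlonglongrightarrow> 0"
    using assms by (simp add: metric.limitin_metric_dist_null)
  then show "(\<lambda>n. hnorm H (u n \<ominus> y)) \<longlonglongrightarrow> 0" using y assms(2) by (simp add: hdist_def)
qed

text \<open>Bessel bounds the coefficient sums. Along finite sets that nearly exhaust their total
  \<open>s\<close> the partial Fourier sums are Cauchy; their limit has the coefficients of
  \<open>x\<close>, hence is \<open>x\<close>, and Pythagoras identifies \<open>s\<close> with the
  squared norm.\<close>

lemma Parseval:
  assumes complete: "metric.mcomplete" and B: "orthonormal_basis H (carrier H) B"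
    and x: "x \<in> carrier H"
  shows "((\<lambda>e. (cmod (inner_prod H x e))\<^sup>2) has_sum (hnorm H x)\<^sup>2) B"
proof -
  let ?f = "\<lambda>e. (cmod (inner_prod H x e))\<^sup>2"
  have oB: "orthonormal B" using B by (rule orthonormal_basis_imp_orthonormal)
  have BH: "B \<subseteq> carrier H" using oB by (simp add: orthonormal_def)
  note oF = orthonormal_subset[OF oB]
  have sm: "?f summable_on B"
  proof (rule nonneg_bdd_above_summable_on)
    show "bdd_above (sum ?f ` {F. F \<subseteq> B \<and> finite F})"
      using Bessel[OF _ oF x] by (intro bdd_aboveI[of _ "(hnorm H x)\<^sup>2"]) blast
  qed simp
  define s where "s = infsum ?f B"
  have le_s: "sum ?f F \<le> s" if "finite F" "F \<subseteq> B" for F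
    unfolding s_def by (rule finite_sum_le_infsum[OF sm that]) simp
  have "\<exists>E. finite E \<and> E \<subseteq> B \<and> s - sum ?f E < inverse (real (Suc n))" for n
  proof -
    obtain E where "finite E" "E \<subseteq> B" "dist (sum ?f E) s \<le> inverse (real (Suc (Suc n)))"
      using infsum_finite_approximation[OF sm, of "inverse (real (Suc (Suc n)))"]
      unfolding s_def by auto
    moreover have "inverse (real (Suc (Suc n))) < inverse (real (Suc n))" by simp
    ultimately have "s - sum ?f E < inverse (real (Suc n))"
      by (simp only: dist_real_def abs_le_iff) linarith
    with \<open>finite E\<close> \<open>E \<subseteq> B\<close> show ?thesis by blast
  qed
  then obtain E where E: "\<And>n. finite (E n)" "\<And>n. E n \<subseteq> B"
    "\<And>n. s - sum ?f (E n) < inverse (real (Suc n))" by metis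
  \<comment> \<open>Unions make the sets increase, as \<open>inner_proj_proj\<close> needs for
    comparing two stages.\<close>
  define F where "F n = (\<Union>i\<le>n. E i)" for n
  have F: "finite (F n)" "F n \<subseteq> B" for n using E by (auto simp: F_def)
  have Fmono: "F m \<subseteq> F n" if "m \<le> n" for m n unfolding F_def using that by (intro UN_mono) auto
  have Fs: "s - sum ?f (F n) < inverse (real (Suc n))" for n
  proof -
    have "sum ?f (E n) \<le> sum ?f (F n)" by (rule sum_mono2[OF F(1)]) (auto simp: F_def)
    with E(3)[of n] show ?thesis by linarith
  qed
  define y where "y n = proj (F n) x" for n
  have yH: "y n \<in> carrier H" for n using F[of n] BH by (simp add: y_def)
  have dist_le: "(hnorm H (y m \<ominus> y n))\<^sup>2 < inverse (real (Suc m))" if "m \<le> n" for m n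
  proof -
    note pp = inner_proj_proj(1)[OF F(1) _ F(1) oF[OF F(2)] x]
    have "(hnorm H (y m \<ominus> y n))\<^sup>2 = sum ?f (F n) - sum ?f (F m)"
      unfolding hnorm_diff_square[OF yH yH] hnorm_square[OF yH]
      unfolding y_def pp[OF Fmono[OF that]] pp[OF order_refl] by simp
    also have "\<dots> < inverse (real (Suc m))" using le_s[OF F, of n] Fs[of m] by simp
    finally show ?thesis .
  qed
  have "metric.MCauchy y"
    unfolding metric.MCauchy_def
  proof (intro conjI allI impI)
    show "range y \<subseteq> carrier H" using yH by auto
    fix \<epsilon> :: real assume "0 < \<epsilon>"
    obtain N where N: "inverse (real (Suc N)) < \<epsilon>\<^sup>2"
      using reals_Archimedean[of "\<epsilon>\<^sup>2"] \<open>0 < \<epsilon>\<close> by auto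
    have *: "hdist H (y n) (y n') < \<epsilon>" if "N \<le> n" "n \<le> n'" for n n'
    proof -
      have "inverse (real (Suc n)) \<le> inverse (real (Suc N))" using that by simp
      with dist_le[OF that(2)] N have "(hnorm H (y n \<ominus> y n'))\<^sup>2 < \<epsilon>\<^sup>2" by linarith
      then show ?thesis using \<open>0 < \<epsilon>\<close> yH by (simp add: hdist_def power_less_imp_less_base)
    qed
    show "\<exists>N. \<forall>n n'. N \<le> n \<longrightarrow> N \<le> n' \<longrightarrow> hdist H (y n) (y n') < \<epsilon>"
    proof (intro exI allI impI)
      fix n n' assume "N \<le> n" "N \<le> n'"
      then show "hdist H (y n) (y n') < \<epsilon>"
        using *[of n n'] *[of n' n] metric.commute[of "y n" "y n'"] by (cases "n \<le> n'") auto
    qed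
  qed
  then obtain z where "limitin (norm_topology H) y z sequentially"
    using complete by (auto simp: metric.mcomplete_def)
  note z = limitin_imp_hnorm_tendsto[OF this yH]
  have inv: "(\<lambda>n. inverse (real (Suc n))) \<longlonglongrightarrow> 0" by (rule LIMSEQ_inverse_real_of_nat)
  have "x = z"
  proof (rule orthonormal_basis_eqI[OF B x z(1)])
    fix e assume e: "e \<in> B"
    then have eH: "e \<in> carrier H" using BH by auto
    have lim0: "(\<lambda>n. inner_prod H x e - inner_prod H (y n) e) \<longlonglongrightarrow> 0"
    proof (rule Lim_null_comparison[OF always_eventually], rule allI)
      fix n
      \<comment> \<open>An element outside \<open>F n\<close> still contributes to \<open>s\<close>,
        so its squared coefficient is covered by the mass that \<open>F n\<close> leaves
        over.\<close>
      have "(cmod (inner_prod H x e - inner_prod H (y n) e))\<^sup>2 \<le> s - sum ?f (F n)"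
      proof (cases "e \<in> F n")
        case True
        then show ?thesis using inner_proj_member[OF F oB e] le_s[OF F] by (simp add: y_def)
      next
        case False
        then have "?f e + sum ?f (F n) \<le> s" using le_s[of "insert e (F n)"] F[of n] e by simp
        with False show ?thesis using inner_proj_member[OF F oB e] by (simp add: y_def)
      qed
      with Fs[of n] have "(cmod (inner_prod H x e - inner_prod H (y n) e))\<^sup>2 \<le> inverse (real (Suc n))"
        by linarith
      then show "norm (inner_prod H x e - inner_prod H (y n) e) \<le> sqrt (inverse (real (Suc n)))"
        by (rule real_le_rsqrt)
    next
      show "(\<lambda>n. sqrt (inverse (real (Suc n)))) \<longlonglongrightarrow> 0" using tendsto_real_sqrt[OF inv] by simp
    qed
    have "(\<lambda>n. inner_prod H x e - inner_prod H (y n) e) \<longlonglongrightarrow> inner_prod H x e - inner_prod H z e"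
      by (intro tendsto_intros tendsto_inner[OF z(2) yH z(1) eH])
    from LIMSEQ_unique[OF this lim0] show "inner_prod H x e = inner_prod H z e" by simp
  qed
  have lim0: "(\<lambda>n. (hnorm H (x \<ominus> y n))\<^sup>2) \<longlonglongrightarrow> 0"
  proof -
    have eq: "hnorm H (x \<ominus> y n) = hnorm H (y n \<ominus> x)" for n
      using metric.commute[of x "y n"] x yH by (simp add: hdist_def)
    show ?thesis unfolding eq using tendsto_power[OF z(2)[folded \<open>x = z\<close>], of 2] by simp
  qed
  have eq: "(hnorm H (x \<ominus> y n))\<^sup>2 = (hnorm H x)\<^sup>2 - sum ?f (F n)" for n
    unfolding y_def by (rule hnorm_diff_proj[OF F(1) oF[OF F(2)] x])
  have "(\<lambda>n. sum ?f (F n)) \<longlonglongrightarrow> s"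
  proof (rule tendsto_sandwich[of "\<lambda>n. s - inverse (real (Suc n))" _ _ "\<lambda>n. s"])
    show "\<forall>\<^sub>F n in sequentially. s - inverse (real (Suc n)) \<le> sum ?f (F n)"
      using Fs by (intro always_eventually allI) (simp add: algebra_simps less_imp_le)
    show "\<forall>\<^sub>F n in sequentially. sum ?f (F n) \<le> s" using le_s[OF F] by simp
    show "(\<lambda>n. s - inverse (real (Suc n))) \<longlonglongrightarrow> s" using tendsto_diff[OF tendsto_const inv] by simp
  qed simp
  then have "(\<lambda>n. (hnorm H (x \<ominus> y n))\<^sup>2) \<longlonglongrightarrow> (hnorm H x)\<^sup>2 - s"
    unfolding eq by (intro tendsto_diff tendsto_const)
  from LIMSEQ_unique[OF this lim0] have "(hnorm H x)\<^sup>2 = s" by simp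
  then show ?thesis using has_sum_infsum[OF sm] by (simp only: s_def)
qed

text \<open>The remainder is the inner product of \<open>x \<ominus> proj F x\<close> with
  \<open>y\<close>; Cauchy-Schwarz and Parseval for \<open>x\<close> send it to zero along the
  finite subsets.\<close>

lemma Parseval_inner:
  assumes complete: "metric.mcomplete" and B: "orthonormal_basis H (carrier H) B"
    and x: "x \<in> carrier H" and y: "y \<in> carrier H"
  shows "((\<lambda>e. inner_prod H x e * inner_prod H e y) has_sum inner_prod H x y) B"
proof -
  let ?f = "\<lambda>e. (cmod (inner_prod H x e))\<^sup>2"
  note oF = orthonormal_subset[OF orthonormal_basis_imp_orthonormal[OF B]]
  have BH: "B \<subseteq> carrier H" using B by (simp add: orthonormal_basis_def)
  have "((\<lambda>F. inner_prod H x y - (\<Sum>e\<in>F. inner_prod H x e * inner_prod H e y)) \<longlongrightarrow> 0)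
      (finite_subsets_at_top B)"
  proof (rule Lim_null_comparison)
    show "\<forall>\<^sub>F F in finite_subsets_at_top B.
        norm (inner_prod H x y - (\<Sum>e\<in>F. inner_prod H x e * inner_prod H e y))
          \<le> sqrt ((hnorm H x)\<^sup>2 - sum ?f F) * hnorm H y"
    proof (rule eventually_finite_subsets_at_top_weakI)
      fix F assume F: "finite F" "F \<subseteq> B"
      then have FH: "F \<subseteq> carrier H" using BH by simp
      have "inner_prod H x y - (\<Sum>e\<in>F. inner_prod H x e * inner_prod H e y)
          = inner_prod H (x \<ominus> proj F x) y"
        using x y FH F by (simp add: inner_diff_left inner_proj_left)
      also have "cmod \<dots> \<le> hnorm H (x \<ominus> proj F x) * hnorm H y"
        using x y FH by (intro Cauchy_Schwarz) auto
      also have "hnorm H (x \<ominus> proj F x) = sqrt ((hnorm H x)\<^sup>2 - sum ?f F)"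
        using real_sqrt_unique[OF hnorm_diff_proj[OF F(1) oF[OF F(2)] x] hnorm_ge_0] x FH by simp
      finally show "norm (inner_prod H x y - (\<Sum>e\<in>F. inner_prod H x e * inner_prod H e y))
          \<le> sqrt ((hnorm H x)\<^sup>2 - sum ?f F) * hnorm H y" .
    qed
    have "((\<lambda>F. sqrt ((hnorm H x)\<^sup>2 - sum ?f F) * hnorm H y) \<longlongrightarrow>
        sqrt ((hnorm H x)\<^sup>2 - (hnorm H x)\<^sup>2) * hnorm H y) (finite_subsets_at_top B)"
      using Parseval[OF complete B x] unfolding has_sum_def by (intro tendsto_intros)
    then show "((\<lambda>F. sqrt ((hnorm H x)\<^sup>2 - sum ?f F) * hnorm H y) \<longlongrightarrow> 0) (finite_subsets_at_top B)"
      by simp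
  qed
  then have "((\<lambda>F. inner_prod H x y - (inner_prod H x y - (\<Sum>e\<in>F. inner_prod H x e * inner_prod H e y)))
      \<longlongrightarrow> inner_prod H x y - 0) (finite_subsets_at_top B)"
    by (intro tendsto_diff tendsto_const)
  then show ?thesis by (simp add: has_sum_def)
qed

section \<open>Spectral theorem for compact selfadjoint operators\<close>

lemma compact_op_convergent_subseq:
  assumes T: "compact_op H T" and u: "\<And>n. u n \<in> carrier H" "\<And>n. hnorm H (u n) \<le> 1"
  obtains y r where "y \<in> carrier H" "strict_mono (r :: nat \<Rightarrow> nat)"
    "(\<lambda>n. hnorm H (T (u (r n)) \<ominus> y)) \<longlonglongrightarrow> 0"
proof -
  let ?K = "norm_topology H closure_of (T ` {x \<in> carrier H. hnorm H x \<le> 1})"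
  have TH: "\<And>x. x \<in> carrier H \<Longrightarrow> T x \<in> carrier H" using T by (auto simp: compact_op_def linear_op_def)
  have "T ` {x \<in> carrier H. hnorm H x \<le> 1} \<subseteq> ?K"
    by (rule closure_of_subset) (use TH in auto)
  then have "range (\<lambda>n. T (u n)) \<subseteq> ?K" using u by auto
  moreover have "compactin (norm_topology H) ?K" using T by (simp add: compact_op_def)
  ultimately obtain y r where "strict_mono (r :: nat \<Rightarrow> nat)"
      "limitin (norm_topology H) ((\<lambda>n. T (u n)) \<circ> r) y sequentially"
    unfolding metric.compactin_sequentially by blast
  then show ?thesis
    using limitin_imp_hnorm_tendsto[of "(\<lambda>n. T (u n)) \<circ> r" y] TH u that by (auto simp: o_def)
qed

lemma exists_normalized:
  assumes "x \<in> carrier H" "x \<noteq> \<zero>"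
  obtains c :: real where "c > 0" "hnorm H (of_real c \<odot> x) = 1"
proof (rule that[of "inverse (hnorm H x)"])
  have "hnorm H x > 0" using assms hnorm_eq_0 hnorm_ge_0 by (metis less_eq_real_def)
  then show "inverse (hnorm H x) > 0" "hnorm H (of_real (inverse (hnorm H x)) \<odot> x) = 1"
    using assms by (simp_all add: hnorm_scale norm_inverse)
qed

text \<open>\<open>T\<close> is symmetric and \<open>B\<close> consists of eigenvectors, so
  \<open>T\<close> preserves the orthogonal complement \<open>M\<close> of \<open>B\<close>. The
  maximizing sequence is followed only through inner products; norm convergence is used for its
  images under \<open>T\<close>.\<close>

lemma exists_eigenvector:
  assumes T: "selfadjoint_op H T" "compact_op H T" and B: "B \<subseteq> carrier H"
    and eig: "\<And>e. e \<in> B \<Longrightarrow> \<exists>t::real. T e = of_real t \<odot> e"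
    and z: "z \<in> carrier H" "z \<noteq> \<zero>" "\<And>e. e \<in> B \<Longrightarrow> inner_prod H z e = 0"
  obtains x and t :: real where "x \<in> carrier H" "hnorm H x = 1" "T x = of_real t \<odot> x"
    "\<And>e. e \<in> B \<Longrightarrow> inner_prod H x e = 0"
proof -
  note result = that
  define M where "M = {x \<in> carrier H. \<forall>e\<in>B. inner_prod H x e = 0}"
  have TH: "T x \<in> carrier H" if "x \<in> carrier H" for x
    using T that by (auto simp: compact_op_def linear_op_def)
  have T_add: "T (x \<oplus> y) = T x \<oplus> T y" if "x \<in> carrier H" "y \<in> carrier H" for x y
    using T that by (auto simp: compact_op_def linear_op_def)
  have T_scale: "T (c \<odot> x) = c \<odot> T x" if "x \<in> carrier H" for c x
    using T that by (auto simp: compact_op_def linear_op_def)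
  have sa: "inner_prod H (T x) y = inner_prod H x (T y)" if "x \<in> carrier H" "y \<in> carrier H" for x y
    using T that by (auto simp: selfadjoint_op_def)
  have MH: "x \<in> carrier H" if "x \<in> M" for x using that by (simp add: M_def)
  have TM: "T x \<in> M" if x: "x \<in> M" for x
  proof -
    have "inner_prod H (T x) e = 0" if e: "e \<in> B" for e
    proof -
      obtain t :: real where "T e = of_real t \<odot> e" using eig[OF e] by blast
      then show ?thesis using x e B by (auto simp: M_def sa inner_scale_right subset_iff)
    qed
    then show ?thesis using x TH by (simp add: M_def)
  qed
  have scaleM: "c \<odot> x \<in> M" if "x \<in> M" for c x
    using that B by (auto simp: M_def inner_scale_left subset_iff)
  have addM: "x \<oplus> y \<in> M" if "x \<in> M" "y \<in> M" for x y
    using that B by (auto simp: M_def inner_add_left subset_iff)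
  have normalize: thesis if v: "v \<in> M" "v \<noteq> \<zero>" "T v = of_real t \<odot> v" for v and t :: real
  proof -
    obtain c :: real where c: "c > 0" "hnorm H (of_real c \<odot> v) = 1"
      using exists_normalized v MH by blast
    have "T (of_real c \<odot> v) = of_real t \<odot> (of_real c \<odot> v)"
      by (rule inner_eqI) (use v MH TH in \<open>simp_all add: T_scale inner_scale_left\<close>)
    then show thesis
      using result[of "of_real c \<odot> v" t] c scaleM[OF v(1), of "of_real c"] by (auto simp: M_def)
  qed
  obtain C where C: "\<And>x. x \<in> carrier H \<Longrightarrow> hnorm H (T x) \<le> C * hnorm H x"
    using T by (auto simp: selfadjoint_op_def bounded_op_def)
  \<comment> \<open>The norm of the restriction of \<open>T\<close> to \<open>M\<close>.\<close>
  define s where "s = (SUP x\<in>{x\<in>M. hnorm H x = 1}. hnorm H (T x))"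
  have zM: "z \<in> M" using z by (simp add: M_def)
  obtain c0 :: real where c0: "hnorm H (of_real c0 \<odot> z) = 1"
    using exists_normalized z by blast
  then have ne: "{x\<in>M. hnorm H x = 1} \<noteq> {}" using scaleM[OF zM] by blast
  have bdd: "bdd_above ((\<lambda>x. hnorm H (T x)) ` {x\<in>M. hnorm H x = 1})"
  proof (rule bdd_aboveI2)
    fix x assume "x \<in> {x\<in>M. hnorm H x = 1}"
    then show "hnorm H (T x) \<le> C" using C[of x] MH[of x] by simp
  qed
  have le_s1: "hnorm H (T x) \<le> s" if "x \<in> M" "hnorm H x = 1" for x
    unfolding s_def by (rule cSUP_upper[OF _ bdd]) (use that in simp)
  have le_s: "hnorm H (T x) \<le> s * hnorm H x" if x: "x \<in> M" for x
  proof (cases "x = \<zero>")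
    case True
    then have "hnorm H x = 0" using MH[OF x] hnorm_eq_0 by blast
    then show ?thesis using C[OF MH[OF x]] by simp
  next
    case False
    obtain c :: real where c: "c > 0" "hnorm H (of_real c \<odot> x) = 1"
      using exists_normalized False MH[OF x] by blast
    have "c * hnorm H (T x) \<le> s * (c * hnorm H x)"
      using le_s1[OF scaleM[OF x] c(2)] c x MH TH by (simp add: T_scale hnorm_scale)
    then show ?thesis using c(1) by (simp add: mult.left_commute[of s])
  qed
  have s0: "0 \<le> s"
    using hnorm_ge_0[OF TH[OF MH[OF scaleM[OF zM]]]] le_s1[OF scaleM[OF zM] c0] by (rule order_trans)
  show thesis
  proof (cases "s = 0")
    case True
    \<comment> \<open>\<open>T\<close> vanishes on \<open>M\<close>, so \<open>z\<close> itself is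
      an eigenvector for \<open>0\<close>.\<close>
    then have "hnorm H (T z) = 0" using le_s[OF zM] hnorm_ge_0[OF TH[OF z(1)]] by simp
    then have "T z = \<zero>" using hnorm_eq_0 TH z(1) by blast
    then have "T z = of_real 0 \<odot> z"
      by (intro inner_eqI) (use z in \<open>simp_all add: inner_scale_left inner_zero_left\<close>)
    then show thesis by (rule normalize[OF zM z(2)])
  next
    case False
    then have s: "0 < s" using s0 by simp
    have "\<exists>x. x \<in> M \<and> hnorm H x = 1 \<and> s - inverse (real (Suc n)) < hnorm H (T x)" for n
      using less_cSUP_iff[OF ne bdd, of "s - inverse (real (Suc n))"] by (auto simp: s_def)
    then obtain u where u: "\<And>n. u n \<in> M" "\<And>n. hnorm H (u n) = 1"
      "\<And>n. s - inverse (real (Suc n)) < hnorm H (T (u n))" by metis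
    note uH = MH[OF u(1)]
    have limT0: "(\<lambda>n. hnorm H (T (u n))) \<longlonglongrightarrow> s"
    proof (rule tendsto_sandwich[of "\<lambda>n. s - inverse (real (Suc n))" _ _ "\<lambda>n. s"])
      show "\<forall>\<^sub>F n in sequentially. s - inverse (real (Suc n)) \<le> hnorm H (T (u n))"
        using u(3) by (intro always_eventually allI less_imp_le)
      show "\<forall>\<^sub>F n in sequentially. hnorm H (T (u n)) \<le> s" using le_s1[OF u(1,2)] by simp
      show "(\<lambda>n. s - inverse (real (Suc n))) \<longlonglongrightarrow> s"
        using tendsto_diff[OF tendsto_const LIMSEQ_inverse_real_of_nat] by simp
    qed simp
    have u_le: "hnorm H (u n) \<le> 1" for n using u(2) by simp
    obtain y r where y: "y \<in> carrier H" and r: "strict_mono (r :: nat \<Rightarrow> nat)"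
      and lim: "(\<lambda>n. hnorm H (T (u (r n)) \<ominus> y)) \<longlonglongrightarrow> 0"
      by (rule compact_op_convergent_subseq[OF T(2) uH u_le])
    have lims: "(\<lambda>n. hnorm H (T (u (r n)))) \<longlonglongrightarrow> s"
      using LIMSEQ_subseq_LIMSEQ[OF limT0 r] by (simp add: o_def)
    have limT: "(\<lambda>n. inner_prod H (T (u (r n))) w) \<longlonglongrightarrow> inner_prod H y w" if "w \<in> carrier H" for w
      by (rule tendsto_inner[OF lim TH[OF uH] y that])
    \<comment> \<open>Along the subsequence \<open>s^2 u\<close> is close to \<open>T (T u)\<close>,
      which tends to \<open>T y\<close>; so this is the only candidate for the limit of
      \<open>u\<close>.\<close>
    define v where "v = of_real (inverse (s\<^sup>2)) \<odot> T y"
    have vH: "v \<in> carrier H" using y TH by (simp add: v_def)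
    define d where "d n = of_real (s\<^sup>2) \<odot> u (r n) \<ominus> T (T (u (r n)))" for n
    have dH: "d n \<in> carrier H" for n using uH TH by (simp add: d_def)
    \<comment> \<open>The square expands to \<open>s^4 - 2 * s^2 * |T u|^2 + |T (T u)|^2\<close>,
      and \<open>|T (T u)| \<le> s * |T u|\<close> because \<open>T u\<close> lies in
      \<open>M\<close>. The bound tends to zero as \<open>|T u|\<close> tends to
      \<open>s\<close>.\<close>
    have d_le: "hnorm H (d n) \<le> sqrt (s^4 - s\<^sup>2 * (hnorm H (T (u (r n))))\<^sup>2)" for n
    proof (rule real_le_rsqrt)
      let ?u = "u (r n)"
      have uu: "?u \<in> carrier H" "T ?u \<in> carrier H" "T (T ?u) \<in> carrier H" using uH TH by auto
      have "inner_prod H (of_real (s\<^sup>2) \<odot> ?u) (T (T ?u)) = of_real (s\<^sup>2) * inner_prod H (T ?u) (T ?u)"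
        using inner_scale_left[OF uu(1,3)] sa[OF uu(1,2)] by simp
      then have 1: "Re (inner_prod H (of_real (s\<^sup>2) \<odot> ?u) (T (T ?u))) = s\<^sup>2 * (hnorm H (T ?u))\<^sup>2"
        using uu by (simp add: hnorm_square del: of_real_power)
      have "hnorm H (of_real (s\<^sup>2) \<odot> ?u) = s\<^sup>2"
        using uu(1) u(2)[of "r n"] by (simp add: hnorm_scale del: of_real_power)
      then have 2: "(hnorm H (of_real (s\<^sup>2) \<odot> ?u))\<^sup>2 = s^4" by simp
      have "(hnorm H (d n))\<^sup>2 = s^4 - 2 * (s\<^sup>2 * (hnorm H (T ?u))\<^sup>2) + (hnorm H (T (T ?u)))\<^sup>2"
        unfolding d_def using hnorm_diff_square[OF smult_in[OF uu(1)] uu(3)] by (simp only: 1 2)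
      also have "(hnorm H (T (T ?u)))\<^sup>2 \<le> (s * hnorm H (T ?u))\<^sup>2"
        using le_s[OF TM[OF u(1)]] hnorm_ge_0[OF uu(3)] by (rule power_mono)
      finally show "(hnorm H (d n))\<^sup>2 \<le> s^4 - s\<^sup>2 * (hnorm H (T ?u))\<^sup>2"
        by (simp add: power_mult_distrib)
    qed
    have approx: "(\<lambda>n. hnorm H (d n)) \<longlonglongrightarrow> 0"
    proof (rule Lim_null_comparison[OF always_eventually])
      show "\<forall>n. norm (hnorm H (d n)) \<le> sqrt (s^4 - s\<^sup>2 * (hnorm H (T (u (r n))))\<^sup>2)"
        using d_le hnorm_ge_0[OF dH] by simp
      have "(\<lambda>n. sqrt (s^4 - s\<^sup>2 * (hnorm H (T (u (r n))))\<^sup>2)) \<longlonglongrightarrow> sqrt (s^4 - s\<^sup>2 * s\<^sup>2)"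
        by (intro tendsto_intros lims)
      then show "(\<lambda>n. sqrt (s^4 - s\<^sup>2 * (hnorm H (T (u (r n))))\<^sup>2)) \<longlonglongrightarrow> 0"
        by (simp flip: power_add)
    qed
    have limu: "(\<lambda>n. inner_prod H (u (r n)) w) \<longlonglongrightarrow> inner_prod H v w" if w: "w \<in> carrier H" for w
    proof -
      have "(\<lambda>n. inner_prod H (d n) w) \<longlonglongrightarrow> 0"
      proof (rule Lim_null_comparison[OF always_eventually])
        show "\<forall>n. norm (inner_prod H (d n) w) \<le> hnorm H (d n) * hnorm H w"
          using Cauchy_Schwarz[OF dH w] by simp
        show "(\<lambda>n. hnorm H (d n) * hnorm H w) \<longlonglongrightarrow> 0"
          using tendsto_mult_right[OF approx, of "hnorm H w"] by simp
      qed
      then have "(\<lambda>n. of_real (inverse (s\<^sup>2)) * (inner_prod H (d n) w + inner_prod H (T (u (r n))) (T w)))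
          \<longlonglongrightarrow> of_real (inverse (s\<^sup>2)) * (0 + inner_prod H y (T w))"
        by (intro tendsto_intros limT TH w)
      moreover have "of_real (inverse (s\<^sup>2)) * (inner_prod H (d n) w + inner_prod H (T (u (r n))) (T w))
          = inner_prod H (u (r n)) w" for n
      proof -
        note un = uH[of "r n"]
        have "inner_prod H (d n) w + inner_prod H (T (u (r n))) (T w)
            = of_real (s\<^sup>2) * inner_prod H (u (r n)) w"
          unfolding d_def inner_diff_left[OF smult_in[OF un] TH[OF TH[OF un]] w]
            inner_scale_left[OF un w] sa[OF TH[OF un] w] by simp
        then show ?thesis using s by simp
      qed
      moreover have "of_real (inverse (s\<^sup>2)) * (0 + inner_prod H y (T w)) = inner_prod H v w"
        unfolding v_def inner_scale_left[OF TH[OF y] w] sa[OF y w] by simp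
      ultimately show ?thesis by simp
    qed
    have Tv: "T v = y"
    proof (rule inner_eqI[OF TH[OF vH] y])
      fix w assume w: "w \<in> carrier H"
      have "(\<lambda>n. inner_prod H (T (u (r n))) w) \<longlonglongrightarrow> inner_prod H v (T w)"
        using limu[OF TH[OF w]] uH w by (simp add: sa)
      then show "inner_prod H (T v) w = inner_prod H y w"
        using LIMSEQ_unique[OF _ limT[OF w]] vH w by (simp add: sa)
    qed
    have vM: "v \<in> M"
    proof -
      have "inner_prod H v e = 0" if e: "e \<in> B" for e
        using LIMSEQ_unique[OF limu[of e]] e B u(1) by (auto simp: M_def subset_iff)
      then show ?thesis using vH by (simp add: M_def)
    qed
    \<comment> \<open>A weak limit of unit vectors may vanish. Here \<open>T u\<close> converges to
      \<open>y\<close> in norm with norms tending to \<open>s > 0\<close>, and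
      \<open>T v = y\<close>.\<close>
    have "y \<noteq> \<zero>"
    proof
      assume "y = \<zero>"
      have "T (u (r n)) \<ominus> \<zero> = T (u (r n))" for n
        by (rule inner_eqI) (use uH TH in \<open>simp_all add: inner_diff_left inner_zero_left\<close>)
      then have "(\<lambda>n. hnorm H (T (u (r n)))) \<longlonglongrightarrow> 0" using lim \<open>y = \<zero>\<close> by simp
      then show False using LIMSEQ_unique[OF lims] s by auto
    qed
    moreover have "T \<zero> = \<zero>"
      using C[of \<zero>] hnorm_eq_0[of \<zero>] hnorm_eq_0[of "T \<zero>"] hnorm_ge_0[of "T \<zero>"] TH[of \<zero>] by simp
    ultimately have v0: "v \<noteq> \<zero>" using Tv by auto
    have TTv: "T (T v) = of_real (s\<^sup>2) \<odot> v"
    proof (rule inner_eqI)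
      show "inner_prod H (T (T v)) w = inner_prod H (of_real (s\<^sup>2) \<odot> v) w" if w: "w \<in> carrier H" for w
      proof -
        have "inner_prod H v w = of_real (inverse (s\<^sup>2)) * inner_prod H (T y) w"
          unfolding v_def by (rule inner_scale_left[OF TH[OF y] w])
        then show ?thesis unfolding Tv inner_scale_left[OF vH w] using s by simp
      qed
    qed (use vH TH in auto)
    \<comment> \<open>\<open>T - s\<close> kills this vector since \<open>T (T v)\<close> is
      \<open>s^2\<close> times \<open>v\<close>. If it is zero, \<open>v\<close> has eigenvalue
      \<open>- s\<close>; otherwise it is itself an eigenvector for \<open>s\<close>.\<close>
    let ?w = "T v \<oplus> of_real s \<odot> v"
    show thesis
    proof (cases "?w = \<zero>")
      case True
      have "T v = of_real (- s) \<odot> v"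
      proof (rule inner_eqI)
        fix q assume q: "q \<in> carrier H"
        have "inner_prod H ?w q = 0" using True q by (simp add: inner_zero_left)
        then show "inner_prod H (T v) q = inner_prod H (of_real (- s) \<odot> v) q"
          using q vH TH by (simp add: inner_add_left inner_scale_left add_eq_0_iff2)
      qed (use vH TH in auto)
      then show thesis by (rule normalize[OF vM v0])
    next
      case False
      have "T ?w = of_real s \<odot> ?w"
        by (rule inner_eqI)
           (use vH TH in \<open>simp_all add: T_add T_scale TTv inner_add_left inner_scale_left
              power2_eq_square algebra_simps\<close>)
      then show thesis by (rule normalize[OF addM[OF TM[OF vM] scaleM[OF vM]] False])
    qed
  qed
qed

text \<open>The images of infinitely many such eigenvectors would be pairwise orthogonal with norms
  at least \<open>t\<close>, hence too far apart for a convergent subsequence.\<close>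

lemma finite_large_eigenvalues:
  assumes T: "compact_op H T" and B: "orthonormal B"
    and eig: "\<And>e. e \<in> B \<Longrightarrow> T e = of_real (\<mu> e) \<odot> e" and t: "0 < t"
  shows "finite {e\<in>B. t \<le> \<bar>\<mu> e\<bar>}"
proof (rule ccontr)
  assume "infinite {e\<in>B. t \<le> \<bar>\<mu> e\<bar>}"
  then obtain f :: "nat \<Rightarrow> 'a" where f: "inj f" "range f \<subseteq> {e\<in>B. t \<le> \<bar>\<mu> e\<bar>}"
    using infinite_countable_subset by blast
  have fB: "f n \<in> B" "t \<le> \<bar>\<mu> (f n)\<bar>" for n using f(2) by auto
  have fH: "f n \<in> carrier H" for n using fB B by (auto simp: orthonormal_def)
  have TH: "T x \<in> carrier H" if "x \<in> carrier H" for x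
    using T that by (auto simp: compact_op_def linear_op_def)
  have ip: "inner_prod H (f m) (f n) = (if m = n then 1 else 0)" for m n
    using fB B f(1) by (auto simp: orthonormal_def dest: injD)
  have norm1: "hnorm H (f n) = 1" for n by (simp add: hnorm_def ip)
  then have "hnorm H (f n) \<le> 1" for n by simp
  then obtain y r where y: "y \<in> carrier H" and r: "strict_mono (r :: nat \<Rightarrow> nat)"
    and lim: "(\<lambda>n. hnorm H (T (f (r n)) \<ominus> y)) \<longlonglongrightarrow> 0"
    by (rule compact_op_convergent_subseq[OF T fH])
  obtain N where N: "\<And>n. n \<ge> N \<Longrightarrow> norm (hnorm H (T (f (r n)) \<ominus> y)) < t / 2"
    using LIMSEQ_D[OF lim, of "t/2"] t by auto
  let ?m = "r N" and ?n = "r (Suc N)"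
  have mn: "?m \<noteq> ?n" using strict_mono_eq[OF r] by simp
  have d: "hdist H (T (f (r n))) y < t / 2" if "n \<ge> N" for n
    using N[OF that] fH TH y by (simp add: hdist_def)
  have "hdist H (T (f ?m)) (T (f ?n)) \<le> hdist H (T (f ?m)) y + hdist H y (T (f ?n))"
    using fH TH y by (intro metric.triangle) auto
  also have "\<dots> < t" using d[of N] d[of "Suc N"] by (simp add: metric.commute[of y])
  finally have "hnorm H (T (f ?m) \<ominus> T (f ?n)) < t" using fH TH by (simp add: hdist_def)
  moreover have "0 \<le> hnorm H (T (f ?m) \<ominus> T (f ?n))" using fH TH by (simp add: hnorm_ge_0)
  ultimately have "(hnorm H (T (f ?m) \<ominus> T (f ?n)))\<^sup>2 < t\<^sup>2"
    by (intro power_strict_mono) auto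
  moreover have "(hnorm H (T (f ?m) \<ominus> T (f ?n)))\<^sup>2 = \<bar>\<mu> (f ?m)\<bar>\<^sup>2 + \<bar>\<mu> (f ?n)\<bar>\<^sup>2"
    using eig[OF fB(1)] fH mn norm1
    by (simp add: hnorm_diff_square inner_scale_left inner_scale_right ip hnorm_scale)
  moreover have "t\<^sup>2 \<le> \<bar>\<mu> (f ?m)\<bar>\<^sup>2" by (rule power_mono[OF fB(2)]) (use t in simp)
  moreover have "0 \<le> \<bar>\<mu> (f ?n)\<bar>\<^sup>2" by simp
  ultimately show False by linarith
qed

theorem compact_selfadjoint_diagonalizes:
  assumes T: "selfadjoint_op H T" "compact_op H T"
  obtains B \<mu> where "diagonalizes H T B \<mu>" "\<And>t. 0 < t \<Longrightarrow> finite {e\<in>B. t \<le> \<bar>\<mu> e\<bar>}"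
proof -
  let ?P = "\<lambda>B. orthonormal B \<and> (\<forall>e\<in>B. \<exists>t::real. T e = of_real t \<odot> e)"
  have "\<exists>B\<in>{B. ?P B}. \<forall>X\<in>{B. ?P B}. B \<subseteq> X \<longrightarrow> X = B"
  proof (rule subset_Zorn')
    fix \<C> assume C: "subset.chain {B. ?P B} \<C>"
    then have P: "?P X" if "X \<in> \<C>" for X using that by (auto simp: subset_chain_def)
    \<comment> \<open>Any two elements of the union lie in a common member of the chain.\<close>
    have "inner_prod H e f = (if e = f then 1 else 0)" if ef: "e \<in> \<Union>\<C>" "f \<in> \<Union>\<C>" for e f
    proof -
      obtain X Y where XY: "X \<in> \<C>" "Y \<in> \<C>" "e \<in> X" "f \<in> Y" using ef by auto
      moreover from XY C have "X \<subseteq> Y \<or> Y \<subseteq> X" by (auto simp: subset_chain_def)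
      ultimately obtain Z where "Z \<in> \<C>" "e \<in> Z" "f \<in> Z" by blast
      then show ?thesis using P[of Z] unfolding orthonormal_def by blast
    qed
    moreover have "\<Union>\<C> \<subseteq> carrier H" using P unfolding orthonormal_def by blast
    ultimately have "orthonormal (\<Union>\<C>)" unfolding orthonormal_def by blast
    moreover have "\<forall>e\<in>\<Union>\<C>. \<exists>t::real. T e = of_real t \<odot> e" using P by blast
    ultimately show "\<Union>\<C> \<in> {B. ?P B}" by blast
  qed
  then obtain B where B: "?P B" and max: "\<And>X. ?P X \<Longrightarrow> B \<subseteq> X \<Longrightarrow> X = B" by auto
  have BH: "B \<subseteq> carrier H" using B by (simp add: orthonormal_def)
  have TH: "T x \<in> carrier H" if "x \<in> carrier H" for x
    using T that by (auto simp: compact_op_def linear_op_def)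
  have "z = \<zero>" if z: "z \<in> carrier H" "\<forall>e\<in>B. inner_prod H z e = 0" for z
  proof (rule ccontr)
    assume "z \<noteq> \<zero>"
    obtain x and t :: real where x: "x \<in> carrier H" "hnorm H x = 1" "T x = of_real t \<odot> x"
        "\<And>e. e \<in> B \<Longrightarrow> inner_prod H x e = 0"
      using exists_eigenvector[OF T BH, of z] B z \<open>z \<noteq> \<zero>\<close> by metis
    have xx: "inner_prod H x x = 1"
      by (subst inner_self_real[OF x(1)]) (use hnorm_square[OF x(1)] x(2) in simp)
    have ex: "inner_prod H e x = 0" if "e \<in> B" for e
      using inner_commute[of x e] x that BH by auto
    have "orthonormal (insert x B)"
      using B x ex xx by (auto simp: orthonormal_def)
    then have "?P (insert x B)" using B x by auto
    then have "x \<in> B" using max[of "insert x B"] by auto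
    then show False using x(4) xx by force
  qed
  then have onb: "orthonormal_basis H (carrier H) B"
    using B by (auto simp: orthonormal_basis_def orthonormal_def)
  obtain \<mu> :: "'a \<Rightarrow> real" where \<mu>: "\<And>e. e \<in> B \<Longrightarrow> T e = of_real (\<mu> e) \<odot> e"
    using B by metis
  \<comment> \<open>Symmetry moves \<open>T\<close> onto the eigenvector, and its real eigenvalue
    leaves the second slot unconjugated.\<close>
  have "inner_prod H (T x) e = of_real (\<mu> e) * inner_prod H x e" if "x \<in> carrier H" "e \<in> B" for x e
    using T(1) that BH \<mu>[of e] by (auto simp: selfadjoint_op_def inner_scale_right subset_iff)
  then have "diagonalizes H T B \<mu>" using onb TH by (simp add: diagonalizes_def)
  then show thesis using that finite_large_eigenvalues[OF T(2) _ \<mu>] B by blast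
qed

section \<open>Eigenspaces, multiplicities and the eigenvalue lists\<close>

lemma eigenspace_diagonalizes:
  assumes "diagonalizes H A B \<mu>"
  shows "eigenspace H A t = {x \<in> carrier H. \<forall>e\<in>B. \<mu> e \<noteq> t \<longrightarrow> inner_prod H x e = 0}"
proof -
  have B: "orthonormal_basis H (carrier H) B" "B \<subseteq> carrier H"
    and A: "\<And>x. x \<in> carrier H \<Longrightarrow> A x \<in> carrier H"
    and ip: "\<And>x e. x \<in> carrier H \<Longrightarrow> e \<in> B \<Longrightarrow> inner_prod H (A x) e = of_real (\<mu> e) * inner_prod H x e"
    using assms by (auto simp: diagonalizes_def orthonormal_basis_def)
  show ?thesis
  proof (intro subset_antisym subsetI)
    fix x assume "x \<in> eigenspace H A t"
    then have x: "x \<in> carrier H" "A x = of_real t \<odot> x" by (auto simp: eigenspace_def)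
    \<comment> \<open>The coefficient of \<open>A x\<close> at \<open>e\<close> is both
      \<open>\<mu> e\<close> and \<open>t\<close> times that of \<open>x\<close>.\<close>
    have "inner_prod H x e = 0" if "e \<in> B" "\<mu> e \<noteq> t" for e
      using ip[OF x(1) that(1)] x that B(2) by (auto simp: inner_scale_left subset_iff)
    then show "x \<in> {x \<in> carrier H. \<forall>e\<in>B. \<mu> e \<noteq> t \<longrightarrow> inner_prod H x e = 0}" using x by simp
  next
    fix x assume x: "x \<in> {x \<in> carrier H. \<forall>e\<in>B. \<mu> e \<noteq> t \<longrightarrow> inner_prod H x e = 0}"
    have "A x = of_real t \<odot> x"
      by (rule orthonormal_basis_eqI[OF B(1)])
         (use x A ip B(2) in \<open>auto simp: inner_scale_left subset_iff\<close>)
    then show "x \<in> eigenspace H A t" using x by (simp add: eigenspace_def)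
  qed
qed

text \<open>Double counting: the squared moduli of the inner products between the two bases add up
  to one along every row and every column, so their total is either cardinality.\<close>

lemma finite_orthonormal_basis_card_eq:
  assumes C: "orthonormal_basis H (eigenspace H A t) C" "finite C"
    and D: "orthonormal_basis H (eigenspace H A t) D" "finite D"
    and A: "diagonalizes H A B \<mu>"
  shows "card C = card D"
proof -
  let ?E = "eigenspace H A t"
  have E: "?E \<subseteq> carrier H" by (auto simp: eigenspace_def)
  have BH: "B \<subseteq> carrier H" using A by (simp add: diagonalizes_def orthonormal_basis_def)
  have on: "orthonormal C" if "orthonormal_basis H ?E C" for C
    using that E by (auto simp: orthonormal_basis_def orthonormal_def)
  have par: "(\<Sum>c\<in>C. (cmod (inner_prod H x c))\<^sup>2) = 1"
    if C: "orthonormal_basis H ?E C" "finite C" and D: "orthonormal_basis H ?E D" "x \<in> D" for C D x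
  proof -
    have CE: "C \<subseteq> ?E" using C by (simp add: orthonormal_basis_def)
    then have CH: "C \<subseteq> carrier H" using E by auto
    have xE: "x \<in> ?E" and x1: "hnorm H x = 1" using D by (auto simp: orthonormal_basis_def hnorm_def)
    then have xH: "x \<in> carrier H" using E by auto
    \<comment> \<open>The remainder stays in the eigenspace, which is described by vanishing
      coefficients; being orthogonal to \<open>C\<close>, it is then zero by the maximality of
      \<open>C\<close> there.\<close>
    have "x \<ominus> proj C x \<in> ?E"
    proof -
      have "inner_prod H (x \<ominus> proj C x) e = 0" if e: "e \<in> B" "\<mu> e \<noteq> t" for e
      proof -
        have "inner_prod H y e = 0" if "y \<in> ?E" for y
          using that e unfolding eigenspace_diagonalizes[OF A] by simp
        then have "inner_prod H x e = 0" "\<And>c. c \<in> C \<Longrightarrow> inner_prod H c e = 0" using xE CE by auto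
        then show ?thesis
          using C CH xH e BH by (simp add: inner_diff_left inner_proj_left subset_iff)
      qed
      then show ?thesis using xH CH unfolding eigenspace_diagonalizes[OF A] by simp
    qed
    moreover have "inner_prod H (x \<ominus> proj C x) c = 0" if "c \<in> C" for c
      using inner_proj_member[OF C(2) order_refl on[OF C(1)] that, of x] that CH xH
      by (auto simp: inner_diff_left subset_iff)
    ultimately have "x \<ominus> proj C x = \<zero>" using C(1) by (auto simp: orthonormal_basis_def)
    then have "hnorm H (x \<ominus> proj C x) = 0" using xH CH by (simp add: hnorm_eq_0)
    then show ?thesis using hnorm_diff_proj[OF C(2) on[OF C(1)] xH] x1 by simp
  qed
  have "real (card D) = (\<Sum>d\<in>D. \<Sum>c\<in>C. (cmod (inner_prod H d c))\<^sup>2)"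
    using par[OF C D(1)] by simp
  also have "\<dots> = (\<Sum>c\<in>C. \<Sum>d\<in>D. (cmod (inner_prod H d c))\<^sup>2)" by (rule sum.swap)
  also have "\<dots> = (\<Sum>c\<in>C. \<Sum>d\<in>D. (cmod (inner_prod H c d))\<^sup>2)"
  proof (intro sum.cong refl)
    fix c d assume "c \<in> C" "d \<in> D"
    then have "c \<in> carrier H" "d \<in> carrier H"
      using on[OF C(1)] on[OF D(1)] by (auto simp: orthonormal_def)
    then show "(cmod (inner_prod H d c))\<^sup>2 = (cmod (inner_prod H c d))\<^sup>2"
      using inner_commute[of c d] by simp
  qed
  also have "\<dots> = real (card C)" using par[OF D C(1)] by simp
  finally show ?thesis by simp
qed

text \<open>The members of \<open>B\<close> with eigenvalue \<open>t\<close> are a basis of the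
  eigenspace. \<open>has_multiplicity\<close> only asks for some basis, so uniqueness of
  \<open>d\<close> rests on \<open>finite_orthonormal_basis_card_eq\<close>.\<close>

lemma has_multiplicity_iff:
  assumes A: "diagonalizes H A B \<mu>" and fin: "finite {e\<in>B. \<mu> e = t}"
  shows "has_multiplicity H A t d \<longleftrightarrow> d = card {e\<in>B. \<mu> e = t}"
proof -
  have B: "orthonormal_basis H (carrier H) B" using A by (simp add: diagonalizes_def)
  have "orthonormal_basis H (eigenspace H A t) {e\<in>B. \<mu> e = t}"
    unfolding eigenspace_diagonalizes[OF A] orthonormal_basis_def
  proof (intro conjI ballI impI subsetI)
    fix e assume "e \<in> {e\<in>B. \<mu> e = t}"
    then show "e \<in> {x \<in> carrier H. \<forall>e\<in>B. \<mu> e \<noteq> t \<longrightarrow> inner_prod H x e = 0}"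
      using B by (auto simp: orthonormal_basis_def)
  next
    fix x assume "x \<in> {x \<in> carrier H. \<forall>e\<in>B. \<mu> e \<noteq> t \<longrightarrow> inner_prod H x e = 0}"
      "\<forall>e\<in>{e\<in>B. \<mu> e = t}. inner_prod H x e = 0"
    then have "x \<in> carrier H" "\<forall>e\<in>B. inner_prod H x e = 0" by blast+
    then show "x = \<zero>" using B unfolding orthonormal_basis_def by blast
  qed (use B in \<open>auto simp: orthonormal_basis_def\<close>)
  then show ?thesis
    using fin finite_orthonormal_basis_card_eq[OF _ _ _ _ A, of t] unfolding has_multiplicity_def by metis
qed

text \<open>Fibre counts give existence in the definite description. Uniqueness is
  \<open>decseq_eqI\<close>, as unique multiplicities fix all fibres over positive
  \<open>t\<close>.\<close>

lemma eig_pos_eq_dec_rearr: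
  assumes A: "diagonalizes H A B \<mu>" and fin: "\<And>t. 0 < t \<Longrightarrow> finite {e\<in>B. t \<le> \<mu> e}"
  shows "eig_pos H A = dec_rearr B \<mu>"
proof -
  have fin': "finite {e\<in>B. \<mu> e = t}" if "0 < t" for t
    by (rule finite_subset[OF _ fin[OF that]]) auto
  note mult = has_multiplicity_iff[OF A fin']
  note fibre = dec_rearr_fibre[OF fin]
  show ?thesis
    unfolding eig_pos_def
  proof (rule the_equality, intro conjI allI impI)
    show "decseq (dec_rearr B \<mu>)" "\<And>i. 0 \<le> dec_rearr B \<mu> i"
      using decseq_dec_rearr[OF fin] dec_rearr_nonneg[OF fin] by auto
    show "finite {i. dec_rearr B \<mu> i = t}" if "0 < t" for t using fibre that by blast
    show "has_multiplicity H A t (card {i. dec_rearr B \<mu> i = t})" if "0 < t" for t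
      using mult[OF that] fibre(2)[OF _ that] by simp
  next
    fix l assume l: "decseq l \<and> (\<forall>i. 0 \<le> l i) \<and>
      (\<forall>t>0. finite {i. l i = t} \<and> has_multiplicity H A t (card {i. l i = t}))"
    show "l = dec_rearr B \<mu>"
    proof (rule decseq_eqI)
      show "decseq (dec_rearr B \<mu>)" "\<And>i. 0 \<le> dec_rearr B \<mu> i"
        using decseq_dec_rearr[OF fin] dec_rearr_nonneg[OF fin] by auto
      show "finite {i. dec_rearr B \<mu> i = t}" if "0 < t" for t using fibre that by blast
      show "card {i. l i = t} = card {i. dec_rearr B \<mu> i = t}" if "0 < t" for t
      proof -
        have "has_multiplicity H A t (card {i. l i = t})" using l that by blast
        then show ?thesis using mult[OF that] fibre(2)[OF _ that] by simp
      qed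
    qed (use l in auto)
  qed
qed

text \<open>Negating a candidate list makes it decreasing and nonnegative, with the fibres
  prescribed by \<open>- \<mu>\<close>; this reduces uniqueness to \<open>decseq_eqI\<close>
  again.\<close>

lemma eig_neg_eq_dec_rearr:
  assumes A: "diagonalizes H A B \<mu>" and fin: "\<And>t. 0 < t \<Longrightarrow> finite {e\<in>B. t \<le> - \<mu> e}"
  shows "eig_neg H A = (\<lambda>i. - dec_rearr B (\<lambda>e. - \<mu> e) i)"
proof -
  let ?d = "dec_rearr B (\<lambda>e. - \<mu> e)"
  have fin': "finite {e\<in>B. \<mu> e = t}" if "t < 0" for t
    by (rule finite_subset[OF _ fin[of "- t"]]) (use that in auto)
  note mult = has_multiplicity_iff[OF A fin']
  note fibre = dec_rearr_fibre[of B "\<lambda>e. - \<mu> e", OF fin]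
  have fibre': "finite {i. - ?d i = t}" "card {i. - ?d i = t} = card {e\<in>B. \<mu> e = t}" if "t < 0" for t
  proof -
    have "{i. - ?d i = t} = {i. ?d i = - t}" "{e\<in>B. \<mu> e = t} = {e\<in>B. - \<mu> e = - t}" by auto
    then show "finite {i. - ?d i = t}" "card {i. - ?d i = t} = card {e\<in>B. \<mu> e = t}"
      using fibre[of "- t"] that by simp_all
  qed
  show ?thesis
    unfolding eig_neg_def
  proof (rule the_equality, intro conjI allI impI)
    show "incseq (\<lambda>i. - ?d i)" "\<And>i. - ?d i \<le> 0"
      using decseq_dec_rearr[of B "\<lambda>e. - \<mu> e", OF fin] dec_rearr_nonneg[of B "\<lambda>e. - \<mu> e", OF fin]
      by (auto simp: incseq_def decseq_def)
    show "finite {i. - ?d i = t}" if "t < 0" for t using fibre' that by blast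
    show "has_multiplicity H A t (card {i. - ?d i = t})" if "t < 0" for t
      using mult[OF that] fibre'(2)[OF that] by simp
  next
    fix l assume l: "incseq l \<and> (\<forall>i. l i \<le> 0) \<and>
      (\<forall>t<0. finite {i. l i = t} \<and> has_multiplicity H A t (card {i. l i = t}))"
    have eq: "{i. - l i = t} = {i. l i = - t}" for t by auto
    have "(\<lambda>i. - l i) = ?d"
    proof (rule decseq_eqI)
      show "decseq ?d" "\<And>i. 0 \<le> ?d i"
        using decseq_dec_rearr[of B "\<lambda>e. - \<mu> e", OF fin] dec_rearr_nonneg[of B "\<lambda>e. - \<mu> e", OF fin]
        by auto
      show "decseq (\<lambda>i. - l i)" "\<And>i. 0 \<le> - l i" using l by (auto simp: incseq_def decseq_def)
      show "finite {i. ?d i = t}" if "0 < t" for t using fibre that by blast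
      show "finite {i. - l i = t}" if "0 < t" for t using l that by (simp add: eq)
      show "card {i. - l i = t} = card {i. ?d i = t}" if "0 < t" for t
      proof -
        have "has_multiplicity H A (- t) (card {i. l i = - t})" using l that by simp
        moreover have "{e\<in>B. - \<mu> e = t} = {e\<in>B. \<mu> e = - t}" by auto
        ultimately show ?thesis using mult[of "- t"] fibre(2)[of t] that unfolding eq by simp
      qed
    qed
    then have "- l i = ?d i" for i by (rule fun_cong)
    then have "l i = - ?d i" for i by (simp only: minus_minus flip: \<open>\<And>i. - l i = ?d i\<close>)
    then show "l = (\<lambda>i. - ?d i)" by (rule ext)
  qed
qed

section \<open>The adjoint and the trace\<close>

lemma adjoint_op_selfadjoint:
  assumes "selfadjoint_op H T" "y \<in> carrier H"
  shows "adjoint_op H T y = T y"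
  unfolding adjoint_op_def
proof (rule the_equality)
  have TH: "T x \<in> carrier H" if "x \<in> carrier H" for x
    using assms that by (auto simp: selfadjoint_op_def bounded_op_def linear_op_def)
  show "T y \<in> carrier H \<and> (\<forall>x\<in>carrier H. inner_prod H (T x) y = inner_prod H x (T y))"
    using assms TH by (auto simp: selfadjoint_op_def)
  fix z assume z: "z \<in> carrier H \<and> (\<forall>x\<in>carrier H. inner_prod H (T x) y = inner_prod H x z)"
  show "z = T y"
  proof (rule inner_eqI)
    fix x assume x: "x \<in> carrier H"
    have "inner_prod H x z = inner_prod H x (T y)" using z x assms by (auto simp: selfadjoint_op_def)
    then show "inner_prod H z x = inner_prod H (T y) x"
      using inner_commute[OF x] z x TH assms(2) by metis
  qed (use z TH assms in auto)
qed

text \<open>For another basis \<open>D\<close> consider the double series of \<open>\<mu> e\<close>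
  times the squared modulus of \<open>inner_prod H e f\<close>. Parseval in \<open>D\<close> makes
  it absolutely summable with row sums \<open>\<mu> e\<close>, so it may be summed in either
  order.\<close>

lemma trace_op_diagonalizes:
  assumes complete: "metric.mcomplete" and A: "diagonalizes H A B \<mu>"
    and sum: "(\<lambda>e. \<bar>\<mu> e\<bar>) summable_on B"
  shows "trace_op H A = of_real (\<Sum>\<^sub>\<infinity>e\<in>B. \<mu> e)"
proof -
  have B: "orthonormal_basis H (carrier H) B" "B \<subseteq> carrier H"
    and AH: "\<And>x. x \<in> carrier H \<Longrightarrow> A x \<in> carrier H"
    and ip: "\<And>x e. x \<in> carrier H \<Longrightarrow> e \<in> B \<Longrightarrow> inner_prod H (A x) e = of_real (\<mu> e) * inner_prod H x e"
    using A by (auto simp: diagonalizes_def orthonormal_basis_def)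
  have sum': "\<mu> summable_on B" using sum summable_on_iff_abs_summable_on_real[of \<mu> B] by simp
  have main: "((\<lambda>f. inner_prod H (A f) f) has_sum of_real (\<Sum>\<^sub>\<infinity>e\<in>B. \<mu> e)) D"
    if D: "orthonormal_basis H (carrier H) D" for D
  proof -
    have DH: "D \<subseteq> carrier H" using D by (simp add: orthonormal_basis_def)
    define g where "g e f = (cmod (inner_prod H e f))\<^sup>2" for e f
    have row: "((\<lambda>f. g e f) has_sum 1) D" if "e \<in> B" for e
    proof -
      have "e \<in> carrier H" "hnorm H e = 1"
        using that B by (auto simp: orthonormal_basis_def hnorm_def)
      then show ?thesis using Parseval[OF complete D, of e] by (simp add: g_def)
    qed
    have "(\<lambda>(e, f). \<bar>\<mu> e\<bar> * g e f) summable_on B \<times> D"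
    proof (rule summable_on_SigmaI)
      show "((\<lambda>f. case (e, f) of (e, f) \<Rightarrow> \<bar>\<mu> e\<bar> * g e f) has_sum \<bar>\<mu> e\<bar>) D" if "e \<in> B" for e
        using has_sum_cmult_right[OF row[OF that], of "\<bar>\<mu> e\<bar>"] by simp
      show "(\<lambda>e. \<bar>\<mu> e\<bar>) summable_on B" by (rule sum)
    qed (auto simp: g_def)
    then have "(\<lambda>p. norm (case p of (e, f) \<Rightarrow> \<mu> e * g e f)) summable_on B \<times> D"
      by (simp add: case_prod_unfold abs_mult g_def)
    then have sm: "(\<lambda>(e, f). \<mu> e * g e f) summable_on B \<times> D"
      by (rule summable_on_iff_abs_summable_on_real[THEN iffD2])
    have "((\<lambda>(e, f). \<mu> e * g e f) has_sum (\<Sum>\<^sub>\<infinity>e\<in>B. \<mu> e)) (B \<times> D)"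
    proof (rule has_sum_SigmaI)
      show "((\<lambda>f. case (e, f) of (e, f) \<Rightarrow> \<mu> e * g e f) has_sum \<mu> e) D" if "e \<in> B" for e
        using has_sum_cmult_right[OF row[OF that], of "\<mu> e"] by simp
      show "(\<mu> has_sum (\<Sum>\<^sub>\<infinity>e\<in>B. \<mu> e)) B" using sum' by (rule has_sum_infsum)
    qed (rule sm)
    then have "((\<lambda>(f, e). \<mu> e * g e f) has_sum (\<Sum>\<^sub>\<infinity>e\<in>B. \<mu> e)) (D \<times> B)"
      by (subst (asm) has_sum_swap) simp
    then have swapped: "((\<lambda>(f, e). complex_of_real (\<mu> e * g e f)) has_sum of_real (\<Sum>\<^sub>\<infinity>e\<in>B. \<mu> e)) (D \<times> B)"
      using has_sum_of_real[of "\<lambda>(f, e). \<mu> e * g e f"] by (simp add: case_prod_unfold)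
    show ?thesis
    \<comment> \<open>Grouped by \<open>f\<close>, the inner sum over \<open>e\<close> is the
      expansion of \<open>inner_prod H (A f) f\<close> in \<open>B\<close>.\<close>
    proof (rule has_sum_SigmaD[OF swapped])
      fix f assume f: "f \<in> D"
      then have fH: "f \<in> carrier H" using DH by auto
      have "((\<lambda>e. inner_prod H (A f) e * inner_prod H e f) has_sum inner_prod H (A f) f) B"
        by (rule Parseval_inner[OF complete B(1) AH[OF fH] fH])
      moreover have "inner_prod H (A f) e * inner_prod H e f = of_real (\<mu> e * g e f)" if "e \<in> B" for e
      proof -
        have "e \<in> carrier H" using that B by auto
        then have "inner_prod H f e = cnj (inner_prod H e f)" using inner_commute fH by blast
        then show ?thesis using ip[OF fH that] by (simp add: g_def complex_norm_square mult_ac del: of_real_power)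
      qed
      ultimately show "((\<lambda>e. case (f, e) of (f, e) \<Rightarrow> complex_of_real (\<mu> e * g e f)) has_sum inner_prod H (A f) f) B"
        by (simp cong: has_sum_cong)
    qed
  qed
  \<comment> \<open>\<open>B\<close> witnesses that a basis exists; without one every
    \<open>t\<close> would satisfy the description vacuously.\<close>
  show ?thesis
    unfolding trace_op_def
    by (rule the_equality) (use main B(1) in \<open>blast intro: has_sum_unique\<close>)+
qed

end

section \<open>Schatten class operators and convergence in eigenvalues\<close>

lemma (in separable_hilbert_space) schatten_selfadjoint_diagonal:
  assumes T: "selfadjoint_op H T" "T \<in> schatten_class p H" and p: "1 \<le> p"
  obtains B :: "'a set" and \<mu> :: "'a \<Rightarrow> real" where "(\<lambda>e. \<bar>\<mu> e\<bar> ^ p) summable_on B"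
    and "\<And>n. p \<le> n \<Longrightarrow> trace_op H (T ^^ n) = of_real (\<Sum>\<^sub>\<infinity>e\<in>B. \<mu> e ^ n)"
    and "eig_pos H T = dec_rearr B \<mu>"
    and "eig_neg H T = (\<lambda>i. - dec_rearr B (\<lambda>e. - \<mu> e) i)"
proof -
  have compact: "compact_op H T" and summable: "summable (\<lambda>i. singular_value H T i ^ p)"
    using T(2) by (auto simp: schatten_class_def)
  obtain B \<mu> where diag: "diagonalizes H T B \<mu>" and fin: "\<And>t. 0 < t \<Longrightarrow> finite {e\<in>B. t \<le> \<bar>\<mu> e\<bar>}"
    using compact_selfadjoint_diagonalizes[OF T(1) compact] by blast
  \<comment> \<open>The eigenvalues of the adjoint composed with \<open>T\<close>; so the singular
    values are the moduli of \<open>\<mu>\<close>, rearranged and padded.\<close>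
  let ?\<nu> = "\<lambda>e. \<mu> e * \<mu> e"
  have finsq: "finite {e\<in>B. t \<le> ?\<nu> e}" if "0 < t" for t
  proof (rule finite_subset[OF _ fin[of "sqrt t"]])
    show "{e \<in> B. t \<le> ?\<nu> e} \<subseteq> {e \<in> B. sqrt t \<le> \<bar>\<mu> e\<bar>}"
      using real_le_lsqrt that by (auto simp: real_sqrt_le_iff simp flip: real_sqrt_abs power2_eq_square)
  qed (use that in simp)
  have "diagonalizes H (T \<circ> T) B ?\<nu>" by (rule diagonalizes_comp[OF diag diag])
  moreover have "\<forall>x\<in>carrier H. T x \<in> carrier H" using diag by (simp add: diagonalizes_def)
  \<comment> \<open>\<open>adjoint_op H T\<close> is known to agree with \<open>T\<close> on the
    carrier, and \<open>diagonalizes\<close> looks at nothing else.\<close>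
  ultimately have "diagonalizes H (adjoint_op H T \<circ> T) B ?\<nu>"
    using adjoint_op_selfadjoint[OF T(1)] by (simp add: diagonalizes_def)
  then have "eig_pos H (adjoint_op H T \<circ> T) = dec_rearr B ?\<nu>"
    using finsq by (rule eig_pos_eq_dec_rearr)
  then have sv: "summable (\<lambda>i. sqrt (dec_rearr B ?\<nu> i) ^ p)"
    using summable by (simp add: singular_value_def)
  obtain g where g: "bij_betw g {i. 0 < dec_rearr B ?\<nu> i} {e\<in>B. 0 < ?\<nu> e}"
    "\<And>i. 0 < dec_rearr B ?\<nu> i \<Longrightarrow> ?\<nu> (g i) = dec_rearr B ?\<nu> i"
    using dec_rearr_bij[of B ?\<nu>, OF finsq] by blast
  have "(\<lambda>i. sqrt (dec_rearr B ?\<nu> i) ^ p) summable_on UNIV"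
    using sv dec_rearr_nonneg[of B ?\<nu>, OF finsq] by (subst summable_on_UNIV_nonneg_real_iff) auto
  then have "(\<lambda>i. sqrt (dec_rearr B ?\<nu> i) ^ p) summable_on {i. 0 < dec_rearr B ?\<nu> i}"
    by (rule summable_on_subset_banach) simp
  then have "(\<lambda>i. \<bar>\<mu> (g i)\<bar> ^ p) summable_on {i. 0 < dec_rearr B ?\<nu> i}"
    by (rule summable_on_cong[THEN iffD1, rotated])
       (use g(2) in \<open>simp flip: real_sqrt_abs power2_eq_square\<close>)
  then have "(\<lambda>e. \<bar>\<mu> e\<bar> ^ p) summable_on {e\<in>B. 0 < ?\<nu> e}"
    using summable_on_reindex_bij_betw[OF g(1), of "\<lambda>e. \<bar>\<mu> e\<bar> ^ p"] by simp
  \<comment> \<open>Elements with eigenvalue \<open>0\<close>, however many, add nothing because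
    \<open>0 ^ p = 0\<close> for \<open>p \<ge> 1\<close>.\<close>
  then have sum: "(\<lambda>e. \<bar>\<mu> e\<bar> ^ p) summable_on B"
    by (rule summable_on_cong_neutral[THEN iffD1, rotated 3])
       (use p in \<open>auto simp: zero_less_mult_iff not_less\<close>)
  show thesis
  proof (rule that[OF sum])
    show "trace_op H (T ^^ n) = of_real (\<Sum>\<^sub>\<infinity>e\<in>B. \<mu> e ^ n)" if "p \<le> n" for n
      by (rule trace_op_diagonalizes[OF complete diagonalizes_funpow[OF diag]])
         (use abs_power_summable_higher[OF sum that] in \<open>simp add: power_abs\<close>)
    show "eig_pos H T = dec_rearr B \<mu>"
    proof (rule eig_pos_eq_dec_rearr[OF diag])
      show "finite {e\<in>B. t \<le> \<mu> e}" if "0 < t" for t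
        by (rule finite_subset[OF _ fin[OF that]]) auto
    qed
    show "eig_neg H T = (\<lambda>i. - dec_rearr B (\<lambda>e. - \<mu> e) i)"
    proof (rule eig_neg_eq_dec_rearr[OF diag])
      show "finite {e\<in>B. t \<le> - \<mu> e}" if "0 < t" for t
        by (rule finite_subset[OF _ fin[OF that]]) auto
    qed
  qed
qed

text \<open>The sign does not depend on \<open>k\<close>, so convergence of the moments passes to
  the negated families, which describe the nonpositive eigenvalues.\<close>

lemma infsum_minus_power:
  fixes \<mu> :: "'a \<Rightarrow> real"
  shows "(\<Sum>\<^sub>\<infinity>e\<in>B. (- \<mu> e) ^ n) = (- 1) ^ n * (\<Sum>\<^sub>\<infinity>e\<in>B. \<mu> e ^ n)"
  by (subst power_minus) (rule infsum_cmult_right')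

theorem proposition2p8:
  fixes H :: "'a inner_space" and Hs :: "nat \<Rightarrow> 'b inner_space"
    and a :: "'a \<Rightarrow> 'a" and as :: "nat \<Rightarrow> 'b \<Rightarrow> 'b" and p :: nat
  assumes "separable_hilbert_space H"
    and "\<And>k. k \<ge> 1 \<Longrightarrow> separable_hilbert_space (Hs k)"
    and "selfadjoint_op H a"
    and "\<And>k. k \<ge> 1 \<Longrightarrow> selfadjoint_op (Hs k) (as k)"
    and "p \<ge> 1"
    and "a \<in> schatten_class p H"
    and "\<And>k. k \<ge> 1 \<Longrightarrow> as k \<in> schatten_class p (Hs k)"
    and "\<And>n. n \<ge> p \<Longrightarrow>
      (\<lambda>k. trace_op (Hs k) (as k ^^ n)) \<longlonglongrightarrow> trace_op H (a ^^ n)"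
  shows "converges_in_eigenvalues Hs as H a"
proof -
  obtain B :: "'a set" and \<mu> :: "'a \<Rightarrow> real" where sum: "(\<lambda>e. \<bar>\<mu> e\<bar> ^ p) summable_on B"
    and tr: "\<And>n. p \<le> n \<Longrightarrow> trace_op H (a ^^ n) = of_real (\<Sum>\<^sub>\<infinity>e\<in>B. \<mu> e ^ n)"
    and eig: "eig_pos H a = dec_rearr B \<mu>" "eig_neg H a = (\<lambda>i. - dec_rearr B (\<lambda>e. - \<mu> e) i)"
    by (rule separable_hilbert_space.schatten_selfadjoint_diagonal[OF assms(1,3,6,5)]) (rule that)
  \<comment> \<open>The hypotheses start at index \<open>1\<close>, so everything is shifted by
    \<open>Suc\<close>, which does not affect limits. Bundling the four facts lets a single choice
    produce all \<open>C k\<close> and \<open>\<nu> k\<close>.\<close>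
  define P where "P k C \<nu> \<longleftrightarrow> (\<lambda>e. \<bar>\<nu> e\<bar> ^ p) summable_on C \<and>
      (\<forall>n\<ge>p. trace_op (Hs (Suc k)) (as (Suc k) ^^ n) = of_real (\<Sum>\<^sub>\<infinity>e\<in>C. \<nu> e ^ n)) \<and>
      eig_pos (Hs (Suc k)) (as (Suc k)) = dec_rearr C \<nu> \<and>
      eig_neg (Hs (Suc k)) (as (Suc k)) = (\<lambda>i. - dec_rearr C (\<lambda>e. - \<nu> e) i)"
    for k and C :: "'b set" and \<nu>
  have "\<exists>C \<nu>. P k C \<nu>" for k
  proof -
    have k: "1 \<le> Suc k" by simp
    obtain C :: "'b set" and \<nu> :: "'b \<Rightarrow> real" where "(\<lambda>e. \<bar>\<nu> e\<bar> ^ p) summable_on C"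
      and "\<And>n. p \<le> n \<Longrightarrow> trace_op (Hs (Suc k)) (as (Suc k) ^^ n) = of_real (\<Sum>\<^sub>\<infinity>e\<in>C. \<nu> e ^ n)"
      and "eig_pos (Hs (Suc k)) (as (Suc k)) = dec_rearr C \<nu>"
      and "eig_neg (Hs (Suc k)) (as (Suc k)) = (\<lambda>i. - dec_rearr C (\<lambda>e. - \<nu> e) i)"
      by (rule separable_hilbert_space.schatten_selfadjoint_diagonal
          [OF assms(2)[OF k] assms(4)[OF k] assms(7)[OF k] assms(5)]) (rule that)
    then have "P k C \<nu>" unfolding P_def by (intro conjI allI impI)
    then show ?thesis by blast
  qed
  then obtain C \<nu> where "\<And>k. P k (C k) (\<nu> k)" by metis
  then have sumk: "\<And>k. (\<lambda>e. \<bar>\<nu> k e\<bar> ^ p) summable_on C k"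
    and trk: "\<And>n k. p \<le> n \<Longrightarrow>
      trace_op (Hs (Suc k)) (as (Suc k) ^^ n) = of_real (\<Sum>\<^sub>\<infinity>e\<in>C k. \<nu> k e ^ n)"
    and eigk: "\<And>k. eig_pos (Hs (Suc k)) (as (Suc k)) = dec_rearr (C k) (\<nu> k)"
      "\<And>k. eig_neg (Hs (Suc k)) (as (Suc k)) = (\<lambda>i. - dec_rearr (C k) (\<lambda>e. - \<nu> k e) i)"
    unfolding P_def by blast+
  \<comment> \<open>The traces are embedded real sums, so their complex convergence is real
    convergence.\<close>
  have lim: "(\<lambda>k. \<Sum>\<^sub>\<infinity>e\<in>C k. \<nu> k e ^ n) \<longlonglongrightarrow> (\<Sum>\<^sub>\<infinity>e\<in>B. \<mu> e ^ n)" if "p \<le> n" for n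
    using LIMSEQ_Suc[OF assms(8)[OF that]] by (simp add: tr trk that tendsto_of_real_iff)
  have lim': "(\<lambda>k. \<Sum>\<^sub>\<infinity>e\<in>C k. (- \<nu> k e) ^ n) \<longlonglongrightarrow> (\<Sum>\<^sub>\<infinity>e\<in>B. (- \<mu> e) ^ n)" if "p \<le> n" for n
    unfolding infsum_minus_power by (intro tendsto_mult_left lim that)
  have "(\<lambda>k. dec_rearr (C k) (\<nu> k) i) \<longlonglongrightarrow> dec_rearr B \<mu> i" for i
    by (rule dec_rearr_tendsto[OF sum sumk assms(5) lim])
  moreover have "(\<lambda>k. dec_rearr (C k) (\<lambda>e. - \<nu> k e) i) \<longlonglongrightarrow> dec_rearr B (\<lambda>e. - \<mu> e) i" for i
    by (rule dec_rearr_tendsto[where p = p]) (use sum sumk assms(5) lim' in auto)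
  ultimately have
    "(\<lambda>k. eig_pos (Hs (Suc k)) (as (Suc k)) i) \<longlonglongrightarrow> eig_pos H a i"
    "(\<lambda>k. eig_neg (Hs (Suc k)) (as (Suc k)) i) \<longlonglongrightarrow> eig_neg H a i" for i
    by (simp_all add: eig eigk tendsto_minus)
  then show ?thesis
    unfolding converges_in_eigenvalues_def by (auto intro: LIMSEQ_imp_Suc)
qed

end
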